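(* Fix $N\ge1$, $0\le j\le J-1$, $e\in E_T^{j+1}$, and let $\sigma\in\mathbb{L}^\infty(E_T^{j+2}\times[0,T];\mathcal{S}^n_+)$ be fixed. For $M\in\mathbb{N}\cup\{\infty\}$ consider the equation $$\left\{\begin{aligned}dp_t(\sigma)&=\left[p_t(\sigma)c_t(\sigma)p_t(\sigma)+a_t(\sigma)p_t(\sigma)+p_t(\sigma)a_t^*(\sigma)-b_t(\sigma)\right]dt,\quad t_{|e|}<t\le T,\\ p_T(\sigma)&=M^{-1}I_n\end{aligned}\right.\tag{G$_M$}$$ (with $M^{-1}I_n:=0_n$ if $M=\infty$), where, for $t_{|e|}<t\le T$, $$\begin{aligned}a_t(\sigma)&:=A_j(e,t)+\tfrac12I_n-\int_E\sigma(e\oplus(t,\theta),t)\left[I_n+\sigma(e\oplus(t,\theta),t)\right]^{-1}\left[C_j(e,t,\theta)+I_n\right]\lambda(\gamma_{|e|},t)Q(\gamma_{|e|},t,d\theta),\\ b_t(\sigma)&:=NB_j(e,t)B_j(e,t)^*+\int_E\sigma(e\oplus(t,\theta),t)\left[I_n+\sigma(e\oplus(t,\theta),t)\right]^{-1}\lambda(\gamma_{|e|},t)Q(\gamma_{|e|},t,d\theta),\\ c_t(\sigma)&:=\int_E\left[C_j^*(e,t,\theta)+I_n\right]\left[I_n+\sigma(e\oplus(t,\theta),t)\right]^{-1}\left[C_j(e,t,\theta)+I_n\right]\lambda(\gamma_{|e|},t)Q(\gamma_{|e|},t,d\theta).\end{aligned}$$ 1. One has $a(\sigma)\in\mathbb{L}^\infty([0,T];\mathbb{R}^{n\times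 n})$, $b(\sigma),c(\sigma)\in\mathbb{L}^\infty([0,T];\mathcal{S}^n_+)$ and $$\|a_t(\sigma)\|\le\|A\|_\infty+\tfrac12+\|\lambda\|_\infty(\|C\|_\infty+1),\quad\|b_t(\sigma)\|\le N\|B\|_\infty^2+\|\lambda\|_\infty,\quad\|c_t(\sigma)\|\le\|\lambda\|_\infty(\|C\|_\infty+1)^2.$$ 2. (i) Equation (G$_M$) admits a unique positive semi-definite solution $p(\sigma)\in\mathbb{L}^\infty([0,T];\mathcal{S}_+^n)$. (ii) The $\mathbb{L}^\infty$ norm of $p(\sigma)$ can be bounded from above independently of $\sigma$ and of $M\ge1$. (iii) For $M<\infty$ fixed, there exists a constant $c_M>0$, independent of $\sigma$, such that $p_t(\sigma)\ge c_MI_n$ for all $t\in[0,T]$. 3. Let $\eta\in\mathbb{L}^\infty(E_T^{j+2}\times[0,T];\mathcal{S}^n_+)$ and $M'\in\mathbb{N}\cup\{\infty\}$. Let $p(\eta)$ be the solution of the equation (G$_{M'}$) associated to $\eta$ (i.e. with coefficients $a(\eta),b(\eta),c(\eta)$ and $p_T(\eta)=(M')^{-1}I_n$), and $p(\sigma)$ the solution of (G$_M$) associated to $\sigma$. If $\eta\le\sigma$ and $M\le M'$, then $p_t(\eta)\le p_t(\sigma)$ for all $t_{|e|}\le t\le T$. (Inequalities between matrices are in the sense of symmetric matrices.)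
   Context: Fix $T>0$, integers $J>1$, $n,d\ge1$. $E$ is a metric space, $\Delta\notin E$ an isolated cemetery state. $\lambda:E\times\mathbb{R}_+\to\mathbb{R}_+$ is continuous and bounded (with supremum $\|\lambda\|_\infty$), extended by $\lambda(\Delta,t)=0$; $Q:E\times\mathbb{R}_+\to\mathcal{P}(E)$ (probability measures on $E$) satisfies $Q(\gamma,t,\{\gamma\})=0$, and $\gamma\mapsto Q(\gamma,t,\cdot)$ is weakly continuous uniformly in $t$. $E_T:=([0,T]\times E)\cup\{(\infty,\Delta)\}$ and $E_T^{k+1}$ is its $(k+1)$-fold product; its elements are histories $e=(t_0,\gamma_0,t_1,\gamma_1,\dots,t_k,\gamma_k)$ of jump times and modes ($t_0=0$), and we write $|e|=k$, $t_{|e|}:=t_k$, $\gamma_{|e|}:=\gamma_k$. For $T\ge t>t_{|e|}$ and $\theta\in E$, $e\oplus(t,\theta):=(t_0,\gamma_0,\dots,t_{|e|},\gamma_{|e|},t,\theta)\in E_T^{|e|+2}$. $\mathcal{S}^n$ (resp. $\mathcal{S}^n_+$) is the space of symmetric (resp. symmetric positive semi-definite) $n\times n$ matrices; $^*$ is transposition; $I_n,0_n$ are the identity and zero matrices; $\|\cdot\|$ on matrices is the operator norm induced by the Euclidean norm; $\mathbb{N}$ denotes the positive integers. $\mathbb{L}^\infty(E_T^{j+2}\times[0,T];\mathcal{S}^n_+)$ denotes the bounded Borel measurable $\mathcal{S}^n_+$-valued functions on $E_T^{j+2}\times[0,T]$. $A_j:E_T^{j+1}\times[0,T]\to\mathbb{R}^{n\times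 n}$, $B_j:E_T^{j+1}\times[0,T]\to\mathbb{R}^{n\times d}$, $C_j:E_T^{j+1}\times[0,T]\times E\to\mathbb{R}^{n\times n}$ are measurable functions bounded respectively by the constants $\|A\|_\infty$, $\|B\|_\infty$, $\|C\|_\infty$ (they represent, between the $j$-th and $(j+1)$-th jump of a marked point process with intensity $\lambda$ and post-jump law $Q$, bounded predictable coefficients $A,B,C$ as functions of the history $e$, of time and, for $C$, of the mark). By convention the coefficients $a,b,c$ are set equal to $0$ for $t\le t_{|e|}$, and solutions are extended to $[0,T]$ as constants before $t_{|e|}$, i.e. $p_t=p_{\max\{t,t_{|e|}\}}$. A solution is understood as an absolutely continuous function satisfying the equation in integral form.
   Formalization: The formal statement additionally assumes that, for each γ in E, the map t ↦ Q(γ,t,·) is measurable; without this the coefficients a, b, c can fail to be measurable in t and item 1 is false. *)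

theory Defs
  imports "HOL-Probability.Probability"
begin

section \<open>Matrices\<close>

text \<open>The library order on \<open>real^'n^'n\<close> is the componentwise one, so the order of symmetric
  matrices gets its own symbol.\<close>

definition sym_mats :: "(real^'n^'n) set" where
  "sym_mats = {A. transpose A = A}"

definition psd_mats :: "(real^'n^'n) set" where
  "psd_mats = {A \<in> sym_mats. \<forall>x. 0 \<le> x \<bullet> (A *v x)}"

definition loewner_le :: "real^'n^'n \<Rightarrow> real^'n^'n \<Rightarrow> bool" (infix "\<preceq>" 50) where
  "A \<preceq> B \<longleftrightarrow> B - A \<in> psd_mats"

text \<open>The instance norm on \<open>real^'m^'n\<close> is the Frobenius norm; the operator norm is \<^const>\<open>onorm\<close>.\<close>

definition opnorm :: "real^'m^'n \<Rightarrow> real" where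
  "opnorm A = onorm (\<lambda>x. A *v x)"

definition Linf :: "'x::topological_space set \<Rightarrow> (real^'m^'n) set \<Rightarrow> ('x \<Rightarrow> real^'m^'n) set" where
  "Linf X S = {f \<in> borel_measurable (restrict_space borel X). f \<in> X \<rightarrow> S \<and> bounded (f ` X)}"


section \<open>Histories\<close>

text \<open>The mode space \<open>E\<close> and the cemetery state \<open>\<Delta>\<close> live in a common metric type. A history
  \<open>(t\<^sub>0, \<gamma>\<^sub>0, \<dots>, t\<^sub>k, \<gamma>\<^sub>k)\<close> is the extensional function \<open>i \<mapsto> (t\<^sub>i, \<gamma>\<^sub>i)\<close> on \<open>{..k}\<close>. All values
  beyond \<open>k\<close> being fixed, the subspace topology (hence the Borel sets) of \<open>hist_space T E \<Delta> k\<close> in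
  the type \<open>nat \<Rightarrow> ereal \<times> 'a\<close> is that of the \<open>(k+1)\<close>-fold product. As \<open>E\<close> need not be separable,
  this Borel \<open>\<sigma>\<close>-algebra can be larger than the product \<open>\<sigma>\<close>-algebra.\<close>

type_synonym 'a history = "nat \<Rightarrow> ereal \<times> 'a"

definition jump_space :: "real \<Rightarrow> 'a set \<Rightarrow> 'a \<Rightarrow> (ereal \<times> 'a) set" where
  "jump_space T E \<Delta> = (ereal ` {0..T}) \<times> E \<union> {(\<infinity>, \<Delta>)}"

definition hist_space :: "real \<Rightarrow> 'a set \<Rightarrow> 'a \<Rightarrow> nat \<Rightarrow> 'a history set" where
  "hist_space T E \<Delta> k = {..k} \<rightarrow>\<^sub>E jump_space T E \<Delta>"

text \<open>An extensional function does not determine \<open>|e|\<close>, so the index \<open>k = |e|\<close> of the last jump is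
  passed along.\<close>

definition last_time :: "nat \<Rightarrow> 'a history \<Rightarrow> ereal" where
  "last_time k e = fst (e k)"

definition last_mode :: "nat \<Rightarrow> 'a history \<Rightarrow> 'a" where
  "last_mode k e = snd (e k)"

definition hist_append :: "nat \<Rightarrow> 'a history \<Rightarrow> real \<Rightarrow> 'a \<Rightarrow> 'a history" where
  "hist_append k e t \<theta> = e(Suc k := (ereal t, \<theta>))"


section \<open>Intensity and post-jump law\<close>

text \<open>The supremum includes \<open>\<Delta>\<close>, where the extended \<open>\<lambda>\<close> vanishes; as \<open>\<lambda> \<ge> 0\<close> this matters only
  for empty \<open>E\<close>, where it gives \<open>0\<close> rather than the unspecified \<open>Sup {}\<close>.\<close>

definition intensity_sup :: "'a set \<Rightarrow> 'a \<Rightarrow> ('a \<times> real \<Rightarrow> real) \<Rightarrow> real" where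
  "intensity_sup E \<Delta> lam = (SUP x \<in> insert \<Delta> E \<times> {0..}. lam x)"

definition weakly_continuous_unif ::
    "'a::metric_space set \<Rightarrow> ('a \<Rightarrow> real \<Rightarrow> 'a measure) \<Rightarrow> bool" where
  "weakly_continuous_unif E Q \<longleftrightarrow>
     (\<forall>f::'a \<Rightarrow> real. continuous_on E f \<longrightarrow> bounded (f ` E) \<longrightarrow>
        (\<forall>\<gamma>\<in>E. uniform_limit {0..} (\<lambda>\<gamma>' t. \<integral>\<theta>. f \<theta> \<partial>Q \<gamma>' t) (\<lambda>t. \<integral>\<theta>. f \<theta> \<partial>Q \<gamma> t) (at \<gamma> within E)))"


section \<open>Coefficients and Riccati equation\<close>

text \<open>The measures \<open>Q \<gamma> t\<close> have \<open>E\<close> as their space, so the integrals below are over \<open>E\<close>. Here \<open>A\<close>,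
  \<open>B\<close>, \<open>C\<close> are the functions \<open>A\<^sub>j\<close>, \<open>B\<^sub>j\<close>, \<open>C\<^sub>j\<close> and \<open>j = |e|\<close>.\<close>

definition coef_a ::
    "('a history \<times> real \<Rightarrow> real^'n^'n) \<Rightarrow> ('a history \<times> real \<times> 'a \<Rightarrow> real^'n^'n) \<Rightarrow>
     ('a \<times> real \<Rightarrow> real) \<Rightarrow> ('a \<Rightarrow> real \<Rightarrow> 'a measure) \<Rightarrow> nat \<Rightarrow> 'a history \<Rightarrow>
     ('a history \<times> real \<Rightarrow> real^'n^'n) \<Rightarrow> real \<Rightarrow> real^'n^'n" where
  "coef_a A C lam Q j e \<sigma> t =
     (if last_time j e < ereal t then
        A (e, t) + (1/2) *\<^sub>R mat 1 -
        (\<integral>\<theta>. lam (last_mode j e, t) *\<^sub>R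
            (\<sigma> (hist_append j e t \<theta>, t) ** matrix_inv (mat 1 + \<sigma> (hist_append j e t \<theta>, t))
             ** (C (e, t, \<theta>) + mat 1)) \<partial>Q (last_mode j e) t)
      else 0)"

definition coef_b ::
    "real \<Rightarrow> ('a history \<times> real \<Rightarrow> real^'d^'n) \<Rightarrow>
     ('a \<times> real \<Rightarrow> real) \<Rightarrow> ('a \<Rightarrow> real \<Rightarrow> 'a measure) \<Rightarrow> nat \<Rightarrow> 'a history \<Rightarrow>
     ('a history \<times> real \<Rightarrow> real^'n^'n) \<Rightarrow> real \<Rightarrow> real^'n^'n" where
  "coef_b N B lam Q j e \<sigma> t =
     (if last_time j e < ereal t then
        N *\<^sub>R (B (e, t) ** transpose (B (e, t))) +
        (\<integral>\<theta>. lam (last_mode j e, t) *\<^sub>R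
            (\<sigma> (hist_append j e t \<theta>, t) ** matrix_inv (mat 1 + \<sigma> (hist_append j e t \<theta>, t)))
           \<partial>Q (last_mode j e) t)
      else 0)"

definition coef_c ::
    "('a history \<times> real \<times> 'a \<Rightarrow> real^'n^'n) \<Rightarrow>
     ('a \<times> real \<Rightarrow> real) \<Rightarrow> ('a \<Rightarrow> real \<Rightarrow> 'a measure) \<Rightarrow> nat \<Rightarrow> 'a history \<Rightarrow>
     ('a history \<times> real \<Rightarrow> real^'n^'n) \<Rightarrow> real \<Rightarrow> real^'n^'n" where
  "coef_c C lam Q j e \<sigma> t =
     (if last_time j e < ereal t then
        (\<integral>\<theta>. lam (last_mode j e, t) *\<^sub>R
            ((transpose (C (e, t, \<theta>)) + mat 1)
             ** matrix_inv (mat 1 + \<sigma> (hist_append j e t \<theta>, t))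
             ** (C (e, t, \<theta>) + mat 1)) \<partial>Q (last_mode j e) t)
      else 0)"

definition enat_inv :: "enat \<Rightarrow> real" where
  "enat_inv M = (case M of enat m \<Rightarrow> 1 / real m | \<infinity> \<Rightarrow> 0)"

definition riccati_rhs ::
    "real^'n^'n \<Rightarrow> real^'n^'n \<Rightarrow> real^'n^'n \<Rightarrow> real^'n^'n \<Rightarrow> real^'n^'n" where
  "riccati_rhs a b c p = p ** c ** p + a ** p + p ** transpose a - b"

text \<open>Positive semi-definite solutions, in integral form on all of \<open>[0,T]\<close>. The integrability clause
  together with the integral equation is absolute continuity. With coefficients that vanish for
  \<open>t \<le> t\<^bsub>|e|\<^esub>\<close>, the equation on \<open>[0,T]\<close> is the one on \<open>(t\<^bsub>|e|\<^esub>, T]\<close> together with the extension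
  \<open>p\<^sub>t = p\<^bsub>max {t, t\<^bsub>|e|\<^esub>}\<^esub>\<close>; if \<open>t\<^bsub>|e|\<^esub> = \<infinity>\<close>, it says that \<open>p\<close> is constantly \<open>M\<^sup>-\<^sup>1 I\<close>.\<close>

definition psd_riccati_solution ::
    "real \<Rightarrow> enat \<Rightarrow> (real \<Rightarrow> real^'n^'n) \<Rightarrow> (real \<Rightarrow> real^'n^'n) \<Rightarrow> (real \<Rightarrow> real^'n^'n) \<Rightarrow>
     (real \<Rightarrow> real^'n^'n) \<Rightarrow> bool" where
  "psd_riccati_solution T M a b c p \<longleftrightarrow>
     p \<in> Linf {0..T} psd_mats \<and>
     set_integrable lborel {0..T} (\<lambda>s. riccati_rhs (a s) (b s) (c s) (p s)) \<and>
     (\<forall>t\<in>{0..T}. p t = enat_inv M *\<^sub>R mat 1 -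
        (LINT s:{t..T}|lborel. riccati_rhs (a s) (b s) (c s) (p s)))"

text \<open>\<open>eq_G T N A B C lam Q j e M \<sigma> p\<close>: \<open>p\<close> is a positive semi-definite solution of
  \<open>(G\<^sub>M)\<close> associated to \<open>\<sigma>\<close>.\<close>

definition eq_G ::
    "real \<Rightarrow> real \<Rightarrow> ('a history \<times> real \<Rightarrow> real^'n^'n) \<Rightarrow> ('a history \<times> real \<Rightarrow> real^'d^'n) \<Rightarrow>
     ('a history \<times> real \<times> 'a \<Rightarrow> real^'n^'n) \<Rightarrow> ('a \<times> real \<Rightarrow> real) \<Rightarrow>
     ('a \<Rightarrow> real \<Rightarrow> 'a measure) \<Rightarrow> nat \<Rightarrow> 'a history \<Rightarrow> enat \<Rightarrow>
     ('a history \<times> real \<Rightarrow> real^'n^'n) \<Rightarrow> (real \<Rightarrow> real^'n^'n) \<Rightarrow> bool" where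
  "eq_G T N A B C lam Q j e M \<sigma> p \<longleftrightarrow>
     psd_riccati_solution T M (coef_a A C lam Q j e \<sigma>) (coef_b N B lam Q j e \<sigma>)
       (coef_c C lam Q j e \<sigma>) p"

end

(*
A real symmetric solution D of -D' = R - G D - D G^T with R and D(T) positive semi-definite stays
positive semi-definite: over a step h its quadratic form at x is that of D at the end of the step,
evaluated at x - h G^T x, plus a nonnegative term and an error of order h^2, and the errors of the
T/h steps add up to O(h). Applied to kappa I - p, to p - kappa I with exponential kappa, and to the
difference of two solutions, this yields the upper bound, the lower bound, and uniqueness together
with comparison. Existence follows by truncating the quadratic term to a Lipschitz one, the upper bound
showing afterwards that the truncation is inactive. For the monotonicity in sigma, completing the
square turns the quadratic form at x of the sigma-dependent part of the right-hand side, with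
v = p x, into the integral of <y, (I + sigma)^(-1) y> for y = x + (C + I) v, up to terms that do not
involve sigma; the resolvent is antitone.
*)
theory Submission
  imports Defs
begin

section \<open>Symmetric matrices\<close>

text \<open>The coefficients are only measurable in time, so an argument at a first time of lost
  positivity, which needs a derivative there, fails. Every equation is therefore kept in the form
  \<open>D t = P + integral {t..T} f\<close>, and each use of the positivity result is a choice of
  \<open>G\<close> and of the remainder \<open>R\<close>. The quadratic term may go to either.
  Placed in \<open>G\<close>, half to the left and half to the right, it yields positivity, the
  lower bound and the comparison. Placed in \<open>R\<close>, where its sign helps, it drops out of
  the upper bound, which therefore does not depend on \<open>c\<close> and survives a truncation
  whose radius is chosen in advance. The other obstacle is measurability: \<open>E\<close> need not
  be separable, while a kernel integral asks for the product \<open>\<sigma>\<close>-algebra of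
  times and marks; the second countable time axis secures this. Estimates for the equation use the
  Frobenius norm, the statement uses the operator norm. The bounds on the coefficients are proved
  for the latter directly; elsewhere the dimensional factor between the two is harmless.\<close>

declare transpose_matrix_vector [simp del]

lemma matrix_vector_mult_mult: "(A ** B) *v x = A *v (B *v (x :: real^'n))"
  by (simp add: matrix_vector_mul_assoc)

lemma inner_transpose_left: "(transpose A *v x) \<bullet> y = x \<bullet> (A *v (y :: real^'n))" for A :: "real^'n^'m"
  by (simp add: dot_lmul_matrix transpose_matrix_vector)

lemma inner_transpose_right: "x \<bullet> (transpose A *v y) = (A *v x) \<bullet> (y :: real^'m)" for A :: "real^'n^'m"
  by (metis inner_commute inner_transpose_left)

lemma inner_sym_mats: "A \<in> sym_mats \<Longrightarrow> x \<bullet> (A *v y) = (A *v x) \<bullet> (y :: real^'n)"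
  using inner_transpose_left[of A x y] by (simp add: sym_mats_def)

lemma transpose_add: "transpose (A + B) = transpose A + transpose (B :: real^'n^'m)"
  by (simp add: transpose_def vec_eq_iff)

lemma transpose_diff: "transpose (A - B) = transpose A - transpose (B :: real^'n^'m)"
  by (simp add: transpose_def vec_eq_iff)

lemma transpose_minus: "transpose (- A) = - transpose (A :: real^'n^'m)"
  by (simp add: transpose_def vec_eq_iff)

lemma transpose_zero [simp]: "transpose 0 = (0 :: real^'n^'m)"
  by (simp add: transpose_def vec_eq_iff)

lemmas transpose_simps = transpose_add transpose_diff transpose_minus transpose_scalar matrix_transpose_mul

section \<open>Frobenius norm, bilinearity and measurability of matrix operations\<close>

lemma norm_transpose: "norm (transpose A) = norm (A :: real^'n^'m)"
proof -
  have "(\<Sum>i\<in>UNIV. \<Sum>j\<in>UNIV. (A $ j $ i)\<^sup>2) = (\<Sum>i\<in>UNIV. \<Sum>j\<in>UNIV. (A $ i $ j)\<^sup>2)"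
    by (rule sum.swap)
  then show ?thesis
    by (simp add: norm_vec_def L2_set_def transpose_def sum_nonneg)
qed

lemma norm_matrix_vector_mult: "norm (A *v x) \<le> norm A * norm x" for A :: "real^'n^'m"
proof -
  have "norm (A *v x) = L2_set (\<lambda>i. \<bar>(A $ i) \<bullet> x\<bar>) UNIV"
    by (simp add: norm_vec_def matrix_vector_mul_component)
  also have "\<dots> \<le> L2_set (\<lambda>i. norm (A $ i) * norm x) UNIV"
    by (rule L2_set_mono) (auto simp: Cauchy_Schwarz_ineq2)
  also have "\<dots> = norm A * norm x"
    by (simp add: L2_set_left_distrib norm_vec_def)
  finally show ?thesis .
qed

text \<open>The rows of \<open>A ** B\<close> are \<open>transpose B\<close> applied to the rows of
  \<open>A\<close>, and transposition preserves the Frobenius norm, so the bound for vectors applies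
  row by row.\<close>

lemma norm_matrix_mult: "norm (A ** B) \<le> norm A * norm B" for A :: "real^'n^'m" and B :: "real^'k^'n"
proof -
  have row: "(A ** B) $ i = transpose B *v (A $ i)" for i
    by (simp add: vec_eq_iff matrix_matrix_mult_def matrix_vector_mult_def transpose_def mult.commute)
  have "norm (A ** B) = L2_set (\<lambda>i. norm (transpose B *v (A $ i))) UNIV"
    by (simp add: norm_vec_def[of "A ** B"] row)
  also have "\<dots> \<le> L2_set (\<lambda>i. norm (A $ i) * norm B) UNIV"
    by (intro L2_set_mono) (metis mult.commute norm_matrix_vector_mult norm_transpose, simp)
  also have "\<dots> = norm A * norm B"
    by (simp add: L2_set_left_distrib norm_vec_def[of A])
  finally show ?thesis .
qed

lemma matrix_add_rdistrib': "(A + B) ** C = A ** C + B ** (C :: real^'k^'n)" for A :: "real^'n^'m"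
  by (simp add: matrix_matrix_mult_def vec_eq_iff sum.distrib distrib_right)

lemma bounded_bilinear_matrix_mult:
  "bounded_bilinear ((**) :: real^'n^'m \<Rightarrow> real^'k^'n \<Rightarrow> real^'k^'m)"
proof
  show "\<exists>K. \<forall>A B. norm ((A :: real^'n^'m) ** (B :: real^'k^'n)) \<le> norm A * norm B * K"
    using norm_matrix_mult by (intro exI[of _ 1]) auto
qed (simp_all add: matrix_add_rdistrib' matrix_add_ldistrib scalar_matrix_assoc matrix_scalar_ac)

lemma bounded_linear_transpose: "bounded_linear (transpose :: real^'n^'m \<Rightarrow> real^'m^'n)"
  by (rule bounded_linear_intro[where K=1]) (simp_all add: transpose_simps norm_transpose)

text \<open>Lets a form be evaluated under a Bochner integral over the marks as well as under a
  gauge integral over time.\<close>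

lemma bounded_linear_quadratic_form: "bounded_linear (\<lambda>A :: real^'n^'m. x \<bullet> (A *v y))"
proof (rule bounded_linear_intro[where K="norm x * norm y"])
  fix A :: "real^'n^'m"
  have "norm (x \<bullet> (A *v y)) \<le> norm x * norm (A *v y)"
    by (simp add: Cauchy_Schwarz_ineq2)
  also have "\<dots> \<le> norm x * (norm A * norm y)"
    by (intro mult_left_mono norm_matrix_vector_mult) auto
  finally show "norm (x \<bullet> (A *v y)) \<le> norm A * (norm x * norm y)"
    by (simp add: mult_ac)
qed (simp_all add: matrix_vector_mult_add_rdistrib inner_add_right flip: scaleR_matrix_vector_assoc)

interpretation matrix_mult: bounded_bilinear "(**) :: real^'n^'m \<Rightarrow> real^'k^'n \<Rightarrow> real^'k^'m"
  by (rule bounded_bilinear_matrix_mult)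

lemma quadratic_form_le: "x \<bullet> (A *v y) \<le> norm A * (norm x * norm y)" "- (norm A * (norm x * norm y)) \<le> x \<bullet> (A *v y)"
  for A :: "real^'n^'m"
proof -
  have "\<bar>x \<bullet> (A *v y)\<bar> \<le> norm x * norm (A *v y)"
    by (simp add: Cauchy_Schwarz_ineq2)
  also have "\<dots> \<le> norm x * (norm A * norm y)"
    by (intro mult_left_mono norm_matrix_vector_mult) auto
  finally have "\<bar>x \<bullet> (A *v y)\<bar> \<le> norm A * (norm x * norm y)" by (simp add: mult_ac)
  then show "x \<bullet> (A *v y) \<le> norm A * (norm x * norm y)" "- (norm A * (norm x * norm y)) \<le> x \<bullet> (A *v y)"
    by auto
qed

lemma matrix_measurable_mult [measurable]:
  fixes f :: "'x \<Rightarrow> real^'n^'m" and g :: "'x \<Rightarrow> real^'k^'n"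
  assumes "f \<in> borel_measurable M" "g \<in> borel_measurable M"
  shows "(\<lambda>x. f x ** g x) \<in> borel_measurable M"
  by (rule borel_measurable_continuous_Pair[OF assms]) (intro matrix_mult.continuous_on continuous_intros)

lemma matrix_measurable_transpose [measurable]:
  fixes f :: "'x \<Rightarrow> real^'n^'m"
  assumes "f \<in> borel_measurable M"
  shows "(\<lambda>x. transpose (f x)) \<in> borel_measurable M"
  using assms borel_measurable_continuous_onI[OF linear_continuous_on[OF bounded_linear_transpose]]
  by (rule measurable_compose)

section \<open>Operator norm and its relation to the Frobenius norm\<close>

lemma opnorm_nonneg: "0 \<le> opnorm A" for A :: "real^'n^'m"
  unfolding opnorm_def by (rule onorm_pos_le) simp

text \<open>Every entry is bounded by the operator norm. The constant is crude but depends on the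
  dimensions only, which is all that uniform bounds require.\<close>

lemma norm_le_opnorm: "norm A \<le> real CARD('m) * real CARD('n) * opnorm A" for A :: "real^'n^'m"
proof -
  have "norm A \<le> (\<Sum>i\<in>UNIV. norm (A $ i))"
    by (simp add: norm_vec_def[of A] L2_set_le_sum)
  also have "\<dots> \<le> (\<Sum>i\<in>(UNIV :: 'm set). \<Sum>j\<in>(UNIV :: 'n set). opnorm A)"
  proof (rule sum_mono)
    fix i
    have "norm (A $ i) \<le> (\<Sum>j\<in>UNIV. \<bar>A $ i $ j\<bar>)"
      by (rule norm_le_l1_cart)
    also have "\<dots> \<le> (\<Sum>j\<in>(UNIV :: 'n set). opnorm A)"
      unfolding opnorm_def by (intro sum_mono matrix_component_le_onorm)
    finally show "norm (A $ i) \<le> (\<Sum>j\<in>(UNIV :: 'n set). opnorm A)" .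
  qed
  finally show ?thesis by (simp add: mult_ac)
qed

lemma norm_mult_le_opnorm: "norm (A *v x) \<le> opnorm A * norm x" for A :: "real^'n^'m"
  unfolding opnorm_def by (rule onorm) simp

lemma opnorm_le: "(\<And>x. norm (A *v x) \<le> k * norm x) \<Longrightarrow> 0 \<le> k \<Longrightarrow> opnorm A \<le> k" for A :: "real^'n^'m"
  unfolding opnorm_def by (rule onorm_bound)

text \<open>With the image of a vector as first argument, the form becomes the squared norm of that
  image. Bounding forms instead of images suits integrals, through which forms pass.\<close>

lemma opnorm_le_bilinear:
  fixes A :: "real^'n^'m"
  assumes "\<And>x y. x \<bullet> (A *v y) \<le> k * (norm x * norm y)" "0 \<le> k"
  shows "opnorm A \<le> k"
proof (rule opnorm_le[OF _ assms(2)])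
  fix x
  have "norm (A *v x) * norm (A *v x) \<le> (k * norm x) * norm (A *v x)"
    using assms(1)[of "A *v x" x] by (simp add: dot_square_norm power2_eq_square mult_ac)
  then show "norm (A *v x) \<le> k * norm x"
    using assms(2) by (cases "A *v x = 0") (simp_all add: mult_le_cancel_right_pos)
qed

section \<open>Positive semi-definite matrices and their order\<close>

lemma psd_matsI: "transpose A = A \<Longrightarrow> (\<And>x. 0 \<le> x \<bullet> (A *v x)) \<Longrightarrow> A \<in> psd_mats"
  by (simp add: psd_mats_def sym_mats_def)

lemma psd_matsD: "A \<in> psd_mats \<Longrightarrow> transpose A = A" "A \<in> psd_mats \<Longrightarrow> 0 \<le> x \<bullet> (A *v x)"
  by (auto simp add: psd_mats_def sym_mats_def)

lemma loewner_leI: "transpose A = A \<Longrightarrow> transpose B = B \<Longrightarrow> (\<And>x. x \<bullet> (A *v x) \<le> x \<bullet> (B *v x)) \<Longrightarrow> A \<preceq> B"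
  unfolding loewner_le_def
  by (intro psd_matsI) (auto simp: transpose_simps matrix_vector_mult_diff_rdistrib inner_diff_right)

lemma loewner_leD: "A \<preceq> B \<Longrightarrow> x \<bullet> (A *v x) \<le> x \<bullet> (B *v x)"
  unfolding loewner_le_def using psd_matsD(2)[of "B - A" x]
  by (auto simp: matrix_vector_mult_diff_rdistrib inner_diff_right)

text \<open>By positivity at \<open>\<parallel>y\<parallel> x - \<parallel>x\<parallel> y\<close>.\<close>

lemma opnorm_psd_le:
  fixes A :: "real^'n^'n"
  assumes A: "A \<in> psd_mats" and le: "\<And>x. x \<bullet> (A *v x) \<le> k * (norm x)\<^sup>2" and "0 \<le> k"
  shows "opnorm A \<le> k"
proof (rule opnorm_le_bilinear)
  fix x y :: "real^'n"
  have sym: "y \<bullet> (A *v x) = x \<bullet> (A *v y)"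
    using inner_transpose_right[of y A x] psd_matsD(1)[OF A] by (simp add: inner_commute)
  have *: "2 * (s * r) * (x \<bullet> (A *v y)) \<le> s\<^sup>2 * (x \<bullet> (A *v x)) + r\<^sup>2 * (y \<bullet> (A *v y))" for s r :: real
    using psd_matsD(2)[OF A, of "s *\<^sub>R x - r *\<^sub>R y"] sym
    by (simp add: algebra_simps inner_diff_left inner_diff_right power2_eq_square)
  have "2 * (norm y * norm x) * (x \<bullet> (A *v y)) \<le> (norm y)\<^sup>2 * (x \<bullet> (A *v x)) + (norm x)\<^sup>2 * (y \<bullet> (A *v y))"
    by (rule *)
  also have "\<dots> \<le> (norm y)\<^sup>2 * (k * (norm x)\<^sup>2) + (norm x)\<^sup>2 * (k * (norm y)\<^sup>2)"
    by (intro add_mono mult_left_mono le) auto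
  also have "\<dots> = 2 * (norm y * norm x) * (k * (norm x * norm y))"
    by (simp add: power2_eq_square algebra_simps)
  finally have "(2 * (norm y * norm x)) * (x \<bullet> (A *v y)) \<le> (2 * (norm y * norm x)) * (k * (norm x * norm y))" .
  then have "x \<bullet> (A *v y) \<le> k * (norm x * norm y)" if "0 < norm y * norm x"
    using that by (meson mult_le_cancel_left_pos mult_pos_pos zero_less_numeral)
  moreover have "x \<bullet> (A *v y) \<le> k * (norm x * norm y)" if "x = 0 \<or> y = 0"
    using that by auto
  ultimately show "x \<bullet> (A *v y) \<le> k * (norm x * norm y)"
    by (cases "x = 0 \<or> y = 0") (simp_all add: mult_pos_pos)
qed fact

section \<open>The resolvent of a positive semi-definite matrix\<close>

definition resolvent :: "real^'n^'n \<Rightarrow> real^'n^'n" where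
  "resolvent S = matrix_inv (mat 1 + S)"

lemma inner_one_plus: "x \<bullet> ((mat 1 + S) *v x) = x \<bullet> x + x \<bullet> (S *v (x :: real^'n))"
  by (simp add: matrix_vector_mult_add_rdistrib inner_add_right)

text \<open>\<open>matrix_inv\<close> is a choice, meaningful only once an inverse exists. Here the
  form of \<open>I + S\<close> at \<open>x\<close> is at least \<open>x \<bullet> x\<close>, which
  gives injectivity and, in finite dimension, a two-sided inverse.\<close>

lemma resolvent_inverse:
  fixes S :: "real^'n^'n"
  assumes S: "S \<in> psd_mats"
  shows "(mat 1 + S) ** resolvent S = mat 1" "resolvent S ** (mat 1 + S) = mat 1"
proof -
  have "inj ((*v) (mat 1 + S))"
    unfolding linear_injective_0[OF matrix_vector_mul_linear]
  proof (intro allI impI)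
    fix x assume "(mat 1 + S) *v x = 0"
    then have "x \<bullet> x + x \<bullet> (S *v x) = 0"
      using inner_one_plus[of x S] by simp
    then have "x \<bullet> x \<le> 0"
      using psd_matsD(2)[OF S, of x] by linarith
    then show "x = 0" by (metis inner_eq_zero_iff inner_ge_zero order_antisym)
  qed
  then have "\<exists>A'. (mat 1 + S) ** A' = mat 1 \<and> A' ** (mat 1 + S) = mat 1"
    by (metis matrix_left_invertible_injective matrix_left_right_inverse)
  then have "(mat 1 + S) ** resolvent S = mat 1 \<and> resolvent S ** (mat 1 + S) = mat 1"
    unfolding resolvent_def matrix_inv_def by (rule someI_ex)
  then show "(mat 1 + S) ** resolvent S = mat 1" "resolvent S ** (mat 1 + S) = mat 1" by auto
qed

lemma psd_one_plus_sym: "S \<in> psd_mats \<Longrightarrow> transpose (mat 1 + S) = mat 1 + (S :: real^'n^'n)"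
  by (simp add: transpose_simps psd_matsD)

lemma resolvent_sym:
  fixes S :: "real^'n^'n"
  assumes S: "S \<in> psd_mats"
  shows "transpose (resolvent S) = resolvent S"
proof -
  have "transpose (resolvent S) ** (mat 1 + S) = mat 1"
    by (metis S matrix_transpose_mul psd_one_plus_sym resolvent_inverse(1) transpose_mat)
  then show ?thesis
    by (metis S matrix_mul_assoc matrix_mul_lid matrix_mul_rid resolvent_inverse(1))
qed

text \<open>Reduces the factor occurring in \<open>a\<close> and \<open>b\<close> to the resolvent
  that occurs in \<open>c\<close>, so that all three coefficients depend on one matrix whose
  behaviour under the order is known.\<close>

lemma mult_resolvent_eq:
  fixes S :: "real^'n^'n"
  assumes S: "S \<in> psd_mats"
  shows "S ** resolvent S = mat 1 - resolvent S"
  using resolvent_inverse(1)[OF S] by (simp add: matrix_mult.add_left eq_diff_eq add.commute)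

text \<open>Writing \<open>y = x + S x\<close>, where \<open>x\<close> is the resolvent applied to
  \<open>y\<close>, one has \<open>|y|^2 = |x|^2 + 2 <x, S x> + |S x|^2\<close>, so neither
  \<open>x\<close> nor \<open>S x\<close> is longer than \<open>y\<close>. The same substitution
  shows the signs of \<open><y, x>\<close> and \<open><y, S x>\<close>.\<close>

lemma
  fixes S :: "real^'n^'n"
  assumes S: "S \<in> psd_mats"
  shows opnorm_resolvent_le: "opnorm (resolvent S) \<le> 1"
    and opnorm_mult_resolvent_le: "opnorm (S ** resolvent S) \<le> 1"
    and resolvent_psd: "resolvent S \<in> psd_mats"
    and mult_resolvent_psd: "S ** resolvent S \<in> psd_mats"
proof -
  have y: "y = resolvent S *v y + S *v (resolvent S *v y)" for y
  proof -
    have "y = (mat 1 + S) *v (resolvent S *v y)"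
      by (simp add: resolvent_inverse[OF S] flip: matrix_vector_mult_mult)
    then show ?thesis by (simp add: matrix_vector_mult_add_rdistrib)
  qed
  have norms: "norm (resolvent S *v y) \<le> norm y" "norm (S *v (resolvent S *v y)) \<le> norm y" for y
  proof -
    define x where "x = resolvent S *v y"
    have yx: "y = x + S *v x" unfolding x_def by (rule y)
    have "(norm y)\<^sup>2 = (norm x)\<^sup>2 + 2 * (x \<bullet> (S *v x)) + (norm (S *v x))\<^sup>2"
      unfolding yx power2_norm_eq_inner by (simp add: inner_add_left inner_add_right inner_commute)
    then have "(norm x)\<^sup>2 \<le> (norm y)\<^sup>2" "(norm (S *v x))\<^sup>2 \<le> (norm y)\<^sup>2"
      using psd_matsD(2)[OF S, of x] by (auto intro: order_trans[OF _ add_mono])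
    then show "norm (resolvent S *v y) \<le> norm y" "norm (S *v (resolvent S *v y)) \<le> norm y"
      unfolding x_def[symmetric] by (auto intro: power2_le_imp_le)
  qed
  have forms: "0 \<le> y \<bullet> (resolvent S *v y)" "0 \<le> y \<bullet> (S *v (resolvent S *v y))" for y
  proof -
    define x where "x = resolvent S *v y"
    have yx: "y = x + S *v x" unfolding x_def by (rule y)
    have "0 \<le> y \<bullet> x" "0 \<le> y \<bullet> (S *v x)"
      unfolding yx using psd_matsD(2)[OF S, of x]
      by (auto simp: inner_add_left inner_add_right inner_commute)
    then show "0 \<le> y \<bullet> (resolvent S *v y)" "0 \<le> y \<bullet> (S *v (resolvent S *v y))"
      unfolding x_def .
  qed
  show "opnorm (resolvent S) \<le> 1" "opnorm (S ** resolvent S) \<le> 1"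
    using norms by (auto intro!: opnorm_le simp: matrix_vector_mult_mult)
  show "resolvent S \<in> psd_mats"
    using forms by (auto intro!: psd_matsI resolvent_sym S)
  show "S ** resolvent S \<in> psd_mats"
  proof (rule psd_matsI)
    show "transpose (S ** resolvent S) = S ** resolvent S"
      by (simp add: mult_resolvent_eq S transpose_simps resolvent_sym)
  qed (use forms in \<open>simp add: matrix_vector_mult_mult\<close>)
qed

text \<open>With \<open>x = (I + S)\<^sup>-\<^sup>1 y\<close>, both sides are compared through the concave function
  \<open>x \<mapsto> 2\<langle>x, y\<rangle> - \<langle>x, (I + R) x\<rangle>\<close>, whose maximum is \<open>\<langle>y, (I + R)\<^sup>-\<^sup>1 y\<rangle>\<close>.\<close>

lemma resolvent_antimono:
  fixes R S :: "real^'n^'n"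
  assumes R: "R \<in> psd_mats" and S: "S \<in> psd_mats" and "R \<preceq> S"
  shows "y \<bullet> (resolvent S *v y) \<le> y \<bullet> (resolvent R *v y)"
proof -
  define P where "P = mat 1 + R"
  define x where "x = resolvent S *v y"
  define z where "z = resolvent R *v y"
  have Px: "x \<bullet> ((mat 1 + S) *v x) = x \<bullet> y" and Pz: "P *v z = y"
    unfolding x_def z_def P_def
    by (simp_all add: resolvent_inverse R S flip: matrix_vector_mult_mult)
  have PS: "P \<in> sym_mats"
    unfolding P_def sym_mats_def using psd_one_plus_sym[OF R] by simp
  have "0 \<le> (x - z) \<bullet> (P *v (x - z))"
    unfolding P_def inner_one_plus using psd_matsD(2)[OF R, of "x - z"] by simp
  also have "\<dots> = x \<bullet> (P *v x) - x \<bullet> y - z \<bullet> (P *v x) + z \<bullet> y"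
    by (simp add: matrix_vector_mult_diff_distrib Pz inner_diff_left inner_diff_right)
  also have "z \<bullet> (P *v x) = x \<bullet> y"
    using inner_sym_mats[OF PS, of z x] by (simp add: Pz inner_commute)
  finally have "2 * (x \<bullet> y) - x \<bullet> (P *v x) \<le> z \<bullet> y" by simp
  moreover have "x \<bullet> (P *v x) \<le> x \<bullet> y"
    unfolding Px[symmetric] P_def inner_one_plus using loewner_leD[OF \<open>R \<preceq> S\<close>, of x] by simp
  ultimately show ?thesis by (simp add: x_def z_def inner_commute)
qed


text \<open>By the resolvent identity the difference is a product of one resolvent,
  \<open>S - R\<close> and the other resolvent. Each resolvent has operator norm at most 1 and
  contributes one dimensional factor, hence the square. The Lipschitz bound serves to make the
  resolvent Borel on \<open>psd_mats\<close>.\<close>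

lemma dist_resolvent:
  fixes R S :: "real^'n^'n"
  assumes R: "R \<in> psd_mats" and S: "S \<in> psd_mats"
  shows "dist (resolvent R) (resolvent S) \<le> (real CARD('n) * real CARD('n))\<^sup>2 * dist R S"
proof -
  have "resolvent R - resolvent S = resolvent R ** ((mat 1 + S) - (mat 1 + R)) ** resolvent S"
    unfolding matrix_mult.diff_left matrix_mult.diff_right resolvent_inverse[OF R]
    by (simp add: resolvent_inverse[OF S] flip: matrix_mul_assoc)
  then have "dist (resolvent R) (resolvent S) \<le> norm (resolvent R) * norm (S - R) * norm (resolvent S)"
    unfolding dist_norm
    by (metis (no_types) add_diff_cancel_left mult_right_mono norm_ge_zero norm_matrix_mult order_trans)
  also have "\<dots> \<le> (real CARD('n) * real CARD('n)) * norm (S - R) * (real CARD('n) * real CARD('n))"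
  proof -
    have "norm (resolvent R) \<le> real CARD('n) * real CARD('n)" if "R \<in> psd_mats" for R :: "real^'n^'n"
      using norm_le_opnorm[of "resolvent R"] opnorm_resolvent_le[OF that]
      by (meson mult_left_le mult_nonneg_nonneg of_nat_0_le_iff order_trans)
    with R S show ?thesis by (intro mult_mono) auto
  qed
  finally show ?thesis
    by (simp add: dist_norm norm_minus_commute power2_eq_square mult_ac)
qed

lemma measurable_resolvent:
  fixes f :: "'x \<Rightarrow> real^'n^'n"
  assumes "f \<in> borel_measurable M" "\<And>x. x \<in> space M \<Longrightarrow> f x \<in> psd_mats"
  shows "(\<lambda>x. resolvent (f x)) \<in> borel_measurable M"
proof -
  have "uniformly_continuous_on psd_mats (resolvent :: real^'n^'n \<Rightarrow> real^'n^'n)"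
    using dist_resolvent
    by (intro lipschitz_on_uniformly_continuous[of "(real CARD('n) * real CARD('n))\<^sup>2"] lipschitz_onI) auto
  then have "resolvent \<in> borel_measurable (restrict_space borel (psd_mats :: (real^'n^'n) set))"
    by (intro borel_measurable_continuous_on_restrict uniformly_continuous_imp_continuous)
  moreover have "f \<in> M \<rightarrow>\<^sub>M restrict_space borel psd_mats"
    using assms by (intro measurable_restrict_space2) auto
  ultimately show ?thesis
    by (rule measurable_compose[rotated])
qed

section \<open>Integral equations with measurable coefficients\<close>

text \<open>\<open>F\<close> is Lipschitz in the state but, in time, merely integrable along
  continuous functions, which is what measurable coefficients offer. The iterates converge on the
  whole interval at once because their differences are measured against an exponential
  weight.\<close>

lemma backward_picard:
  fixes F :: "real \<Rightarrow> 'v::euclidean_space \<Rightarrow> 'v" and P :: 'v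
  assumes T: "0 \<le> T" and L: "0 < L"
    and lip: "\<And>s x y. s \<in> {0..T} \<Longrightarrow> norm (F s x - F s y) \<le> L * norm (x - y)"
    and int: "\<And>u. continuous_on {0..T} u \<Longrightarrow> (\<lambda>s. F s (u s)) integrable_on {0..T}"
  obtains u where "continuous_on {0..T} u"
    "\<And>t. t \<in> {0..T} \<Longrightarrow> u t = P + integral {t..T} (\<lambda>s. F s (u s))"
proof -
  define step where "step u t = P + integral {t..T} (\<lambda>s. F s (u s))" for u and t :: real
  define u where "u k = (step ^^ k) (\<lambda>_. P)" for k :: nat
  have u_Suc: "u (Suc k) = step (u k)" for k
    by (simp add: u_def)
  have int': "(\<lambda>s. F s (v s)) integrable_on {t..T}" if "continuous_on {0..T} v" "t \<in> {0..T}" for v t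
    using integrable_subinterval_real[OF int[OF that(1)], of t T] that(2) by auto
  have cont_step: "continuous_on {0..T} (step v)" if "continuous_on {0..T} v" for v
    unfolding step_def using indefinite_integral_continuous_1'[OF int[OF that]]
    by (intro continuous_intros)
  have cont_u: "continuous_on {0..T} (u k)" for k
    by (induction k) (simp_all add: u_Suc cont_step, simp add: u_def)
  have step_diff: "norm (step v t - step w t) \<le> integral {t..T} (\<lambda>s. L * g s)"
    if v: "continuous_on {0..T} v" and w: "continuous_on {0..T} w" and g: "continuous_on {0..T} g"
      and t: "t \<in> {0..T}" and le: "\<And>s. s \<in> {0..T} \<Longrightarrow> norm (v s - w s) \<le> g s" for v w g t
  proof -
    have "step v t - step w t = integral {t..T} (\<lambda>s. F s (v s) - F s (w s))"
      unfolding step_def using int'[OF v t] int'[OF w t] by (simp add: integral_diff)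
    also have "norm \<dots> \<le> integral {t..T} (\<lambda>s. L * g s)"
    proof (rule integral_norm_bound_integral)
      show "(\<lambda>s. F s (v s) - F s (w s)) integrable_on {t..T}"
        by (intro integrable_diff int' v w t)
      show "(\<lambda>s. L * g s) integrable_on {t..T}"
        using t by (intro integrable_continuous_real continuous_intros continuous_on_subset[OF g]) auto
      show "norm (F s (v s) - F s (w s)) \<le> L * g s" if "s \<in> {t..T}" for s
      proof -
        have "s \<in> {0..T}" using that t by auto
        then show ?thesis
          using lip[of s "v s" "w s"] mult_left_mono[OF le[of s], of L] L by linarith
      qed
    qed
    finally show ?thesis .
  qed
  have "bounded ((\<lambda>t. u 1 t - u 0 t) ` {0..T})"
    by (intro compact_imp_bounded compact_continuous_image continuous_intros cont_u) auto
  then obtain B where B: "\<And>t. t \<in> {0..T} \<Longrightarrow> norm (u 1 t - u 0 t) \<le> B" and "B > 0"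
    unfolding bounded_pos by blast
  \<comment> \<open>The rate \<open>2 * L\<close> makes the integral of \<open>L * E\<close> over
    \<open>{t..T}\<close> less than \<open>E t / 2\<close>: in this weight every iteration halves
    the difference, however large \<open>L * T\<close> is.\<close>
  define E where "E t = exp (2 * L * (T - t))" for t :: real
  have contE: "continuous_on S E" for S
    unfolding E_def by (intro continuous_intros)
  have intE: "integral {t..T} (\<lambda>s. L * (c * E s)) = c / 2 * (E t - 1)" if "t \<le> T" for t c
  proof (rule integral_unique)
    have "((\<lambda>s. L * (c * E s)) has_integral (- (c / 2) * E T - - (c / 2) * E t)) {t..T}"
      using that unfolding E_def
      by (intro fundamental_theorem_of_calculus)
         (auto intro!: derivative_eq_intros simp flip: has_real_derivative_iff_has_vector_derivative)
    then show "((\<lambda>s. L * (c * E s)) has_integral c / 2 * (E t - 1)) {t..T}"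
      by (simp add: E_def algebra_simps)
  qed
  have diff: "norm (u (Suc k) t - u k t) \<le> B / 2 ^ k * E t" if "t \<in> {0..T}" for k t
    using that
  proof (induction k arbitrary: t)
    case 0
    then have "B * 1 \<le> B * E t"
      using L \<open>B > 0\<close> by (intro mult_left_mono) (auto simp: E_def)
    then show ?case
      using B[OF 0] by simp
  next
    case (Suc k)
    have "norm (u (Suc (Suc k)) t - u (Suc k) t) \<le> integral {t..T} (\<lambda>s. L * (B / 2 ^ k * E s))"
      unfolding u_Suc[of "Suc k"] u_Suc[of k, THEN arg_cong[where f="\<lambda>f. f t"]]
      by (intro step_diff cont_u Suc continuous_intros contE)
    also have "\<dots> = B / 2 ^ k / 2 * (E t - 1)"
      using Suc.prems by (intro intE) auto
    also have "\<dots> \<le> B / 2 ^ k / 2 * E t"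
      using \<open>B > 0\<close> by (intro mult_left_mono) auto
    finally show ?case by (simp add: field_simps)
  qed
  define v where "v t = u 0 t + (\<Sum>k. u (Suc k) t - u k t)" for t
  have unif: "uniform_limit {0..T} u v sequentially"
  proof -
    have "uniform_limit {0..T} (\<lambda>n t. \<Sum>k<n. u (Suc k) t - u k t) (\<lambda>t. \<Sum>k. u (Suc k) t - u k t) sequentially"
    proof (rule Weierstrass_m_test)
      show "norm (u (Suc k) t - u k t) \<le> B * E 0 * (1 / 2) ^ k" if "t \<in> {0..T}" for k t
      proof -
        have "E t \<le> E 0" using L that by (auto simp: E_def)
        then have "B / 2 ^ k * E t \<le> B / 2 ^ k * E 0"
          using \<open>B > 0\<close> by (intro mult_left_mono) auto
        with diff[OF that, of k] show ?thesis by (simp add: power_divide mult_ac)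
      qed
      show "summable (\<lambda>k. B * E 0 * (1 / 2) ^ k)"
        by (intro summable_mult summable_geometric) auto
    qed
    then have "uniform_limit {0..T} (\<lambda>n t. u 0 t + (\<Sum>k<n. u (Suc k) t - u k t)) v sequentially"
      unfolding v_def by (intro uniform_limit_intros)
    moreover have "u 0 t + (\<Sum>k<n. u (Suc k) t - u k t) = u n t" for n t
      using sum_lessThan_telescope[of "\<lambda>k. u k t" n] by simp
    ultimately show ?thesis by simp
  qed
  have cont_v: "continuous_on {0..T} v"
    by (rule uniform_limit_theorem[OF _ unif]) (auto simp: cont_u)
  have "v t = step v t" if t: "t \<in> {0..T}" for t
  proof (rule LIMSEQ_unique)
    show "(\<lambda>k. u (Suc k) t) \<longlonglongrightarrow> v t"
      using tendsto_uniform_limitI[OF unif t] by (rule LIMSEQ_Suc)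
    show "(\<lambda>k. u (Suc k) t) \<longlonglongrightarrow> step v t"
    proof (rule LIMSEQ_I)
      fix r :: real assume "0 < r"
      \<comment> \<open>\<open>T + 1\<close> instead of \<open>T\<close> keeps the denominator
        positive and the last estimate strict also when \<open>T = 0\<close>.\<close>
      define d where "d = r / (L * (T + 1))"
      have "d > 0" using \<open>0 < r\<close> L T by (auto simp: d_def)
      from uniform_limitD[OF unif this] obtain n where
        n: "\<And>k s. k \<ge> n \<Longrightarrow> s \<in> {0..T} \<Longrightarrow> dist (u k s) (v s) < d"
        unfolding eventually_sequentially by blast
      have "norm (u (Suc k) t - step v t) < r" if "k \<ge> n" for k
      proof -
        have "norm (u (Suc k) t - step v t) \<le> integral {t..T} (\<lambda>s. L * d)"
          unfolding u_Suc using n[OF that] cont_v cont_u t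
          by (intro step_diff) (auto simp: dist_norm intro: less_imp_le)
        also have "\<dots> = (T - t) * (L * d)"
          using t by simp
        also have "\<dots> \<le> T * (L * d)"
          using t L \<open>d > 0\<close> by (intro mult_right_mono) auto
        also have "\<dots> < r"
        proof -
          have "T * (L * d) < (T + 1) * (L * d)"
            using L \<open>d > 0\<close> by (intro mult_strict_right_mono) auto
          also have "\<dots> = r" using L T by (simp add: d_def)
          finally show ?thesis .
        qed
        finally show ?thesis .
      qed
      then show "\<exists>n. \<forall>k\<ge>n. norm (u (Suc k) t - step v t) < r" by blast
    qed
  qed
  with cont_v that show ?thesis by (auto simp: step_def)
qed

section \<open>Positivity for linear Lyapunov equations in integral form\<close>

lemma norm_integral_le:
  fixes f :: "real \<Rightarrow> 'v::euclidean_space"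
  assumes "f integrable_on {a..b}" "\<And>s. s \<in> {a..b} \<Longrightarrow> norm (f s) \<le> K" "a \<le> b"
  shows "norm (integral {a..b} f) \<le> K * (b - a)"
  using integral_norm_bound_integral[OF assms(1) integrable_const_ivl assms(2)] assms(3)
  by (simp add: mult.commute)

text \<open>Writing \<open>h\<close> for the step and \<open>y = x - h G\<^sup>*x\<close>, one has
  \<open>\<langle>x, D t x\<rangle> = \<langle>y, D t' y\<rangle> + \<integral>\<langle>x, R x\<rangle> + O(h\<^sup>2)\<close>: to first order the flow is a congruence plus a
  positive term.\<close>

lemma lyapunov_step:
  fixes D f G R :: "real \<Rightarrow> real^'n^'n"
  assumes f: "f integrable_on {0..T}"
    and D: "\<And>t. t \<in> {0..T} \<Longrightarrow> D t = P + integral {t..T} f"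
    and sym: "\<And>t. t \<in> {0..T} \<Longrightarrow> transpose (D t) = D t"
    and f_eq: "\<And>s. s \<in> {0..T} \<Longrightarrow> f s = R s - (G s ** D s + D s ** transpose (G s))"
    and R: "\<And>s. s \<in> {0..T} \<Longrightarrow> R s \<in> psd_mats"
    and G: "\<And>s. s \<in> {0..T} \<Longrightarrow> norm (G s) \<le> g"
    and K: "\<And>s. s \<in> {0..T} \<Longrightarrow> norm (f s) \<le> K"
    and d: "\<And>s. s \<in> {0..T} \<Longrightarrow> norm (D s) \<le> d"
    and t: "0 \<le> t" "0 < h" "t + h \<le> T" and "0 \<le> m"
    and m: "\<And>x. - (m * (norm x)\<^sup>2) \<le> x \<bullet> (D (t + h) *v x)"
  shows "- ((m * (1 + g * h)\<^sup>2 + (2 * g * K + d * g\<^sup>2) * h\<^sup>2) * (norm x)\<^sup>2) \<le> x \<bullet> (D t *v x)"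
proof -
  define D' where "D' = D (t + h)"
  have fi: "f integrable_on {s..s'}" if "0 \<le> s" "s' \<le> T" for s s'
    using integrable_subinterval_real[OF f, of s s'] that by auto
  have split: "D s = D' + integral {s..t + h} f" if "s \<in> {t..t + h}" for s
  proof -
    have "integral {s..t + h} f + integral {t + h..T} f = integral {s..T} f"
      using that t by (intro Henstock_Kurzweil_Integration.integral_combine fi) auto
    with that t show ?thesis by (simp add: D D'_def algebra_simps)
  qed
  have "g \<ge> 0" using order_trans[OF norm_ge_zero G[of t]] t by auto
  have "K \<ge> 0" using order_trans[OF norm_ge_zero K[of t]] t by auto
  \<comment> \<open>The lower bound required of the form at \<open>x\<close> of
    \<open>D t - D'\<close>, which is the integral of \<open>f\<close> over the step. It suffices
    that the integrand is at least \<open>\<beta> / h\<close> at every \<open>s\<close>. As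
    \<open>G\<close> is only measurable, the vector \<open>y\<close> is built from
    \<open>G s\<close> anew for each \<open>s\<close>, and integration comes last.\<close>
  define \<beta> where "\<beta> = - (x \<bullet> (D' *v x)) - (m * (1 + g * h)\<^sup>2 + (2 * g * K + d * g\<^sup>2) * h\<^sup>2) * (norm x)\<^sup>2"
  have pt: "\<beta> / h \<le> x \<bullet> (f s *v x)" if s: "s \<in> {t..t + h}" for s
  proof -
    have s': "s \<in> {0..T}" using s t by auto
    define w where "w = transpose (G s) *v x"
    define \<delta> where "\<delta> = D s - D'"
    define y where "y = x - h *\<^sub>R w"
    have "norm \<delta> \<le> K * (t + h - s)"
      unfolding \<delta>_def split[OF s] add_diff_cancel_left'
      using s t by (intro norm_integral_le fi K) auto
    also have "\<dots> \<le> K * h" using s \<open>K \<ge> 0\<close> by (intro mult_left_mono) auto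
    finally have \<delta>: "norm \<delta> \<le> K * h" .
    have w: "norm w \<le> g * norm x"
      unfolding w_def using norm_matrix_vector_mult[of "transpose (G s)" x] G[OF s']
      by (metis (no_types) mult_right_mono norm_ge_zero norm_transpose order_trans)
    have symD': "D' \<in> sym_mats"
      unfolding D'_def sym_mats_def using sym[of "t + h"] t by auto
    have x1: "x \<bullet> ((G s ** D s) *v x) = w \<bullet> (D s *v x)"
      unfolding w_def by (simp add: matrix_vector_mult_mult inner_transpose_left)
    have "D s \<in> sym_mats" unfolding sym_mats_def using sym[OF s'] by auto
    then have x2: "x \<bullet> ((D s ** transpose (G s)) *v x) = w \<bullet> (D s *v x)"
      unfolding w_def by (simp add: matrix_vector_mult_mult inner_sym_mats inner_commute)
    have "x \<bullet> (f s *v x) = x \<bullet> (R s *v x) - 2 * (w \<bullet> (D s *v x))"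
      by (simp add: f_eq[OF s'] matrix_vector_mult_diff_rdistrib matrix_vector_mult_add_rdistrib
          inner_diff_right inner_add_right x1 x2)
    also have "w \<bullet> (D s *v x) = w \<bullet> (D' *v x) + w \<bullet> (\<delta> *v x)"
      by (simp add: \<delta>_def matrix_vector_mult_diff_rdistrib inner_diff_right)
    finally have 1: "x \<bullet> (f s *v x) \<ge> - 2 * (w \<bullet> (D' *v x)) - 2 * (w \<bullet> (\<delta> *v x))"
      using psd_matsD(2)[OF R[OF s'], of x] by simp
    have "w \<bullet> (\<delta> *v x) \<le> norm \<delta> * (norm w * norm x)"
      by (rule quadratic_form_le)
    also have "\<dots> \<le> (K * h) * ((g * norm x) * norm x)"
      using w \<delta> \<open>K \<ge> 0\<close> \<open>g \<ge> 0\<close> t by (intro mult_mono) auto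
    finally have 2: "w \<bullet> (\<delta> *v x) \<le> g * K * h * (norm x)\<^sup>2"
      by (simp add: power2_eq_square mult_ac)
    \<comment> \<open>Exchanges the first-order term in \<open>w\<close> and \<open>x\<close> for
      the form of \<open>D'\<close> at \<open>y\<close>, to which the hypothesis on \<open>m\<close>
      applies. The price, the form of \<open>D'\<close> at \<open>w\<close> times
      \<open>h\<^sup>2\<close>, is the source of \<open>d * g\<^sup>2\<close>; the earlier
      replacement of \<open>D s\<close> by \<open>D'\<close> is the source of
      \<open>2 * g * K\<close>.\<close>
    have 3: "y \<bullet> (D' *v y) = x \<bullet> (D' *v x) - 2 * h * (w \<bullet> (D' *v x)) + h\<^sup>2 * (w \<bullet> (D' *v w))"
      using inner_sym_mats[OF symD', of x w]
      by (simp add: y_def inner_diff_left inner_diff_right algebra_simps inner_commute power2_eq_square)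
    have "w \<bullet> (D' *v w) \<le> norm D' * (norm w * norm w)"
      by (rule quadratic_form_le)
    also have "\<dots> \<le> d * ((g * norm x) * (g * norm x))"
    proof (intro mult_mono w)
      show "norm D' \<le> d" unfolding D'_def using d[of "t + h"] t by auto
      then show "0 \<le> d" using norm_ge_zero order_trans by blast
    qed (use \<open>g \<ge> 0\<close> in auto)
    finally have "h\<^sup>2 * (w \<bullet> (D' *v w)) \<le> h\<^sup>2 * (d * ((g * norm x) * (g * norm x)))"
      by (intro mult_left_mono) auto
    then have 4: "h\<^sup>2 * (w \<bullet> (D' *v w)) \<le> d * g\<^sup>2 * h\<^sup>2 * (norm x)\<^sup>2"
      by (simp add: power2_eq_square mult_ac)
    have "norm y \<le> norm x + h * norm w"
      unfolding y_def using norm_triangle_ineq4[of x "h *\<^sub>R w"] t by simp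
    also have "\<dots> \<le> norm x + h * (g * norm x)"
      using t w by (intro add_left_mono mult_left_mono) auto
    finally have "norm y \<le> (1 + g * h) * norm x" by (simp add: algebra_simps)
    then have "(norm y)\<^sup>2 \<le> ((1 + g * h) * norm x)\<^sup>2"
      by (intro power_mono) auto
    then have "m * (norm y)\<^sup>2 \<le> m * ((1 + g * h) * norm x)\<^sup>2"
      using \<open>0 \<le> m\<close> by (rule mult_left_mono)
    with m[of y] have 5: "- (m * (1 + g * h)\<^sup>2 * (norm x)\<^sup>2) \<le> y \<bullet> (D' *v y)"
      by (simp add: D'_def power_mult_distrib mult.assoc)
    have "h * (x \<bullet> (f s *v x)) \<ge> h * (- 2 * (w \<bullet> (D' *v x)) - 2 * (w \<bullet> (\<delta> *v x)))"
      using 1 t by (intro mult_left_mono) auto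
    moreover have "h * (w \<bullet> (\<delta> *v x)) \<le> h * (g * K * h * (norm x)\<^sup>2)"
      using 2 t by (intro mult_left_mono) auto
    ultimately have "\<beta> \<le> h * (x \<bullet> (f s *v x))"
      using 3 4 5 unfolding \<beta>_def by (simp add: algebra_simps power2_eq_square)
    then show ?thesis using t by (simp add: field_simps)
  qed
  have int: "((\<lambda>s. x \<bullet> (f s *v x)) has_integral x \<bullet> (integral {t..t + h} f *v x)) {t..t + h}"
    using has_integral_linear[OF integrable_integral[OF fi] bounded_linear_quadratic_form[of x x]] t
    by (simp add: o_def)
  have "((\<lambda>s. \<beta> / h) has_integral \<beta>) {t..t + h}"
    using has_integral_const_real[of "\<beta> / h" t "t + h"] t by simp
  from has_integral_le[OF this int pt] have "\<beta> \<le> x \<bullet> (integral {t..t + h} f *v x)"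
    by simp
  also have "integral {t..t + h} f = D t - D'"
    using split[of t] t by simp
  finally show ?thesis
    using t by (simp add: \<beta>_def matrix_vector_mult_diff_rdistrib inner_diff_right)
qed

text \<open>A discrete Gronwall argument. A step of length \<open>h\<close> multiplies the defect of
  positivity by \<open>(1 + g * h)\<^sup>2\<close> and adds \<open>C * h\<^sup>2\<close>. After
  \<open>n\<close> steps the defect is at most
  \<open>n * C * h\<^sup>2 * exp (2 * g * h * n)\<close>, which tends to 0 as a fixed interval is
  cut ever finer. \<open>G\<close> and \<open>R\<close> may depend on the unknown itself, and this
  is how nonlinear equations are brought into the linear form.\<close>

lemma lyapunov_psd:
  fixes D f G R :: "real \<Rightarrow> real^'n^'n"
  assumes f: "f integrable_on {0..T}"
    and D: "\<And>t. t \<in> {0..T} \<Longrightarrow> D t = P + integral {t..T} f"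
    and sym: "\<And>t. t \<in> {0..T} \<Longrightarrow> transpose (D t) = D t"
    and P: "P \<in> psd_mats"
    and f_eq: "\<And>s. s \<in> {0..T} \<Longrightarrow> f s = R s - (G s ** D s + D s ** transpose (G s))"
    and R: "\<And>s. s \<in> {0..T} \<Longrightarrow> R s \<in> psd_mats"
    and G: "\<And>s. s \<in> {0..T} \<Longrightarrow> norm (G s) \<le> g"
    and K: "\<And>s. s \<in> {0..T} \<Longrightarrow> norm (f s) \<le> K"
    and t: "t \<in> {0..T}"
  shows "D t \<in> psd_mats"
proof (rule psd_matsI)
  show "transpose (D t) = D t" by (rule sym[OF t])
  fix x
  have "g \<ge> 0" using G[OF t] norm_ge_zero[of "G t"] by linarith
  have "K \<ge> 0" using K[OF t] norm_ge_zero[of "f t"] by linarith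
  define d where "d = norm P + K * T"
  have d: "norm (D s) \<le> d" if s: "s \<in> {0..T}" for s
  proof -
    have "norm (D s) \<le> norm P + norm (integral {s..T} f)"
      unfolding D[OF s] by (rule norm_triangle_ineq)
    also have "norm (integral {s..T} f) \<le> K * (T - s)"
      using s K integrable_subinterval_real[OF f, of s T] by (intro norm_integral_le) auto
    also have "\<dots> \<le> K * T" using s \<open>K \<ge> 0\<close> by (intro mult_left_mono) auto
    finally show ?thesis by (simp add: d_def)
  qed
  define C where "C = 2 * g * K + d * g\<^sup>2"
  have "d \<ge> 0" using d[OF t] norm_ge_zero order_trans by blast
  have "C \<ge> 0" unfolding C_def using \<open>g \<ge> 0\<close> \<open>K \<ge> 0\<close> \<open>d \<ge> 0\<close> by simp
  have bound: "- (real n * C * h\<^sup>2 * exp (2 * g * h * real n) * (norm x)\<^sup>2) \<le> x \<bullet> (D (T - real n * h) *v x)"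
    if h: "0 < h" "real n * h \<le> T" for n h x
    using that
  proof (induction n arbitrary: x)
    case 0
    then show ?case
      using D[of T] psd_matsD(2)[OF P, of x] by simp
  next
    case (Suc n)
    define m where "m = real n * C * h\<^sup>2 * exp (2 * g * h * real n)"
    define t' where "t' = T - real (Suc n) * h"
    have t': "t' + h = T - real n * h" by (simp add: t'_def algebra_simps)
    have nh: "0 \<le> real n * h" using \<open>0 < h\<close> by simp
    have nh': "real n * h \<le> T" using Suc.prems by (simp add: algebra_simps)
    have "m \<ge> 0" unfolding m_def using \<open>C \<ge> 0\<close> by simp
    have m: "- (m * (norm x)\<^sup>2) \<le> x \<bullet> (D (t' + h) *v x)" for x
      unfolding t' m_def using Suc.IH[OF \<open>0 < h\<close> nh'] .
    have le: "- ((m * (1 + g * h)\<^sup>2 + C * h\<^sup>2) * (norm x)\<^sup>2) \<le> x \<bullet> (D t' *v x)"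
      unfolding C_def
      by (rule lyapunov_step[OF f D sym f_eq R G K d _ _ _ \<open>m \<ge> 0\<close> m])
         (use Suc.prems nh in \<open>auto simp: t'_def algebra_simps\<close>)
    have "(1 + g * h)\<^sup>2 \<le> (exp (g * h))\<^sup>2"
      using \<open>g \<ge> 0\<close> \<open>0 < h\<close> by (intro power_mono exp_ge_add_one_self) auto
    also have "\<dots> = exp (2 * g * h)" by (simp add: mult.assoc flip: exp_of_nat_mult)
    finally have "m * (1 + g * h)\<^sup>2 \<le> m * exp (2 * g * h)"
      using \<open>m \<ge> 0\<close> by (rule mult_left_mono)
    also have "\<dots> = real n * C * h\<^sup>2 * exp (2 * g * h * real (Suc n))"
      by (simp add: m_def algebra_simps exp_add)
    finally have "m * (1 + g * h)\<^sup>2 + C * h\<^sup>2 * 1 \<le>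
        real n * C * h\<^sup>2 * exp (2 * g * h * real (Suc n)) + C * h\<^sup>2 * exp (2 * g * h * real (Suc n))"
      using \<open>C \<ge> 0\<close> \<open>g \<ge> 0\<close> \<open>0 < h\<close> by (intro add_mono mult_left_mono) auto
    then have "m * (1 + g * h)\<^sup>2 + C * h\<^sup>2 \<le> real (Suc n) * C * h\<^sup>2 * exp (2 * g * h * real (Suc n))"
      by (simp add: algebra_simps)
    then have "(m * (1 + g * h)\<^sup>2 + C * h\<^sup>2) * (norm x)\<^sup>2 \<le>
        real (Suc n) * C * h\<^sup>2 * exp (2 * g * h * real (Suc n)) * (norm x)\<^sup>2"
      by (rule mult_right_mono) simp
    with le show ?case unfolding t'_def by linarith
  qed
  show "0 \<le> x \<bullet> (D t *v x)"
  proof (cases "t = T")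
    case True
    with bound[of 1 0 x] t show ?thesis by simp
  next
    case False
    \<comment> \<open>With \<open>Suc n\<close> steps of length \<open>(T - t) / Suc n\<close>, the
      bound on the defect is exactly \<open>c / Suc n\<close>.\<close>
    define c where "c = C * (T - t)\<^sup>2 * exp (2 * g * (T - t)) * (norm x)\<^sup>2"
    have ge: "- c / real (Suc n) \<le> x \<bullet> (D t *v x)" for n
    proof -
      define h where "h = (T - t) / real (Suc n)"
      have h: "real (Suc n) * h = T - t" by (simp add: h_def del: of_nat_Suc)
      have "h > 0" using False t by (simp add: h_def)
      have "- (real (Suc n) * C * h\<^sup>2 * exp (2 * g * h * real (Suc n)) * (norm x)\<^sup>2) \<le> x \<bullet> (D (T - real (Suc n) * h) *v x)"
        using \<open>h > 0\<close> h t by (intro bound) auto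
      also have "2 * g * h * real (Suc n) = 2 * g * (T - t)"
        by (simp add: h mult_ac del: of_nat_Suc flip: h)
      also have "real (Suc n) * C * h\<^sup>2 = C * (T - t)\<^sup>2 / real (Suc n)"
        by (simp add: h_def power2_eq_square del: of_nat_Suc)
      also have "T - real (Suc n) * h = t" using h by simp
      finally show ?thesis by (simp add: c_def del: of_nat_Suc)
    qed
    have "(\<lambda>n. - c / real (Suc n)) \<longlonglongrightarrow> 0"
      by (rule LIMSEQ_Suc[OF lim_const_over_n])
    from LIMSEQ_le_const2[OF this] ge show ?thesis by blast
  qed
qed

section \<open>Riccati equations\<close>

lemmas matrix_distribs = matrix_mult.add_left matrix_mult.add_right matrix_mult.diff_left matrix_mult.diff_right
  matrix_mult.scaleR_left matrix_mult.scaleR_right matrix_mult.minus_left matrix_mult.minus_right matrix_mul_assoc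

lemma
  fixes f :: "real \<Rightarrow> 'v::euclidean_space"
  assumes f: "f \<in> borel_measurable (restrict_space borel {0..T})"
    and K: "\<And>t. t \<in> {0..T} \<Longrightarrow> norm (f t) \<le> K" and t: "t \<in> {0..T}"
  shows set_integrable_bounded_measurable: "set_integrable lborel {t..T} f"
    and integrable_on_bounded_measurable: "f integrable_on {t..T}"
    and set_lebesgue_integral_eq_integral: "(LINT s:{t..T}|lborel. f s) = integral {t..T} f"
proof -
  have "(\<lambda>s. indicator {0..T} s *\<^sub>R f s) \<in> borel_measurable borel"
    using f by (subst (asm) borel_measurable_restrict_space_iff) auto
  then have "set_integrable lborel {0..T} f"
    unfolding set_integrable_def using K t
    by (intro integrableI_bounded_set[where A="{0..T}" and B=K]) (auto simp: emeasure_lborel_Icc_eq)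
  then show *: "set_integrable lborel {t..T} f"
    by (rule set_integrable_subset) (use t in auto)
  show "f integrable_on {t..T}" "(LINT s:{t..T}|lborel. f s) = integral {t..T} f"
    by (rule set_borel_integral_eq_integral[OF *])+
qed

text \<open>Integral form of the multiples of the identity that serve as barriers: rate
  \<open>k\<close> for the upper bound, rate \<open>- k\<close> for the lower one.\<close>

lemma has_integral_exp_scaleR:
  fixes X :: "'v::euclidean_space"
  assumes "t \<le> T"
  shows "((\<lambda>s. (k * exp (k * (T - s))) *\<^sub>R X) has_integral (exp (k * (T - t)) - 1) *\<^sub>R X) {t..T}"
proof -
  have "((\<lambda>s. k * exp (k * (T - s))) has_integral (- exp (k * (T - T)) - - exp (k * (T - t)))) {t..T}"
    using assms
    by (intro fundamental_theorem_of_calculus)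
       (auto intro!: derivative_eq_intros simp flip: has_real_derivative_iff_has_vector_derivative)
  from has_integral_scaleR_left[OF this, of X] show ?thesis by simp
qed

lemma norm_add_le: "norm x \<le> r \<Longrightarrow> norm y \<le> s \<Longrightarrow> norm (x + y) \<le> r + s"
  using norm_triangle_mono by blast

lemma norm_diff_le: "norm x \<le> r \<Longrightarrow> norm y \<le> s \<Longrightarrow> norm (x - y) \<le> r + s"
  using norm_triangle_le_diff by (meson add_mono order_trans)

lemma norm_matrix_mult_le:
  fixes A :: "real^'n^'m" and B :: "real^'k^'n"
  assumes "norm A \<le> r" "norm B \<le> s"
  shows "norm (A ** B) \<le> r * s"
proof -
  have "0 \<le> r" using assms(1) norm_ge_zero order_trans by blast
  then have "norm A * norm B \<le> r * s" by (intro mult_mono assms) auto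
  with norm_matrix_mult[of A B] show ?thesis by linarith
qed

lemma riccati_rhs_sym:
  assumes "transpose b = b" "transpose c = c" "transpose p = p"
  shows "transpose (riccati_rhs a b c p) = riccati_rhs a b c (p :: real^'n^'n)"
  using assms by (simp add: riccati_rhs_def transpose_simps matrix_mul_assoc)

lemma norm_riccati_rhs_le:
  fixes a :: "real^'n^'n"
  assumes "norm a \<le> na" "norm b \<le> nb" "norm c \<le> nc" "norm p \<le> r"
  shows "norm (riccati_rhs a b c p) \<le> r * nc * r + na * r + r * na + nb"
  unfolding riccati_rhs_def
  by (intro norm_add_le norm_diff_le norm_matrix_mult_le assms) (simp add: assms norm_transpose)

text \<open>Separates the Riccati equation from the jump process: a constant built from
  \<open>T\<close>, \<open>na\<close>, \<open>nb\<close>, \<open>nc\<close> alone is uniform over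
  all coefficients that share these bounds. The norms are Frobenius norms.\<close>

locale riccati_coefficients =
  fixes T na nb nc :: real and a b c :: "real \<Rightarrow> real^'n^'n"
  assumes T_nonneg: "0 \<le> T"
    and a_meas: "a \<in> borel_measurable (restrict_space borel {0..T})"
    and b_meas: "b \<in> borel_measurable (restrict_space borel {0..T})"
    and c_meas: "c \<in> borel_measurable (restrict_space borel {0..T})"
    and a_le: "\<And>t. t \<in> {0..T} \<Longrightarrow> norm (a t) \<le> na"
    and b_le: "\<And>t. t \<in> {0..T} \<Longrightarrow> norm (b t) \<le> nb"
    and c_le: "\<And>t. t \<in> {0..T} \<Longrightarrow> norm (c t) \<le> nc"
    and b_psd: "\<And>t. t \<in> {0..T} \<Longrightarrow> b t \<in> psd_mats"
    and c_psd: "\<And>t. t \<in> {0..T} \<Longrightarrow> c t \<in> psd_mats"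
begin

lemma bounds_nonneg: "0 \<le> na" "0 \<le> nb" "0 \<le> nc"
  using order_trans[OF norm_ge_zero a_le[of 0]] order_trans[OF norm_ge_zero b_le[of 0]]
    order_trans[OF norm_ge_zero c_le[of 0]] T_nonneg by auto

text \<open>The factor \<open>\<phi>\<close> covers both the Riccati equation (\<open>\<phi> = 1\<close>) and its truncation.\<close>

lemma damped_bounds:
  assumes p: "\<And>t. t \<in> {0..T} \<Longrightarrow> p t = m *\<^sub>R mat 1 + integral {t..T} f"
    and f: "f integrable_on {0..T}"
    and f_eq: "\<And>s. s \<in> {0..T} \<Longrightarrow>
        f s = b s - (\<phi> s *\<^sub>R (p s ** c s ** p s) + a s ** p s + p s ** transpose (a s))"
    and sym: "\<And>s. s \<in> {0..T} \<Longrightarrow> transpose (p s) = p s"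
    and r: "\<And>s. s \<in> {0..T} \<Longrightarrow> norm (p s) \<le> r"
    and \<phi>: "\<And>s. s \<in> {0..T} \<Longrightarrow> 0 \<le> \<phi> s \<and> \<phi> s \<le> 1"
    and m: "0 \<le> m" "m \<le> 1"
    and t: "t \<in> {0..T}"
  shows "p t \<in> psd_mats" "x \<bullet> (p t *v x) \<le> exp ((nb + 2 * na) * (T - t)) * (norm x)\<^sup>2"
proof -
  have "r \<ge> 0" using r[OF t] norm_ge_zero order_trans by blast
  have cp: "norm (\<phi> s *\<^sub>R X) \<le> k" if "s \<in> {0..T}" "norm X \<le> k" for s k and X :: "real^'n^'n"
  proof -
    have "\<phi> s * norm X \<le> 1 * norm X" using \<phi>[OF that(1)] by (intro mult_right_mono) auto
    then show ?thesis using that \<phi>[OF that(1)] by simp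
  qed
  define K where "K = nb + (r * nc * r + na * r + r * na)"
  have K: "norm (f s) \<le> K" if s: "s \<in> {0..T}" for s
    unfolding f_eq[OF s] K_def
    by (intro norm_add_le norm_diff_le norm_matrix_mult_le cp a_le b_le c_le r s)
       (use a_le[OF s] in \<open>simp add: norm_transpose\<close>)
  have c_sym: "transpose (c s) = c s" if "s \<in> {0..T}" for s
    using c_psd[OF that] by (rule psd_matsD)
  show "p t \<in> psd_mats"
  proof (rule lyapunov_psd[OF f p sym _ _ b_psd _ K t])
    show "m *\<^sub>R mat 1 \<in> (psd_mats :: (real^'n^'n) set)"
      using m by (intro psd_matsI) (auto simp: transpose_simps simp flip: scaleR_matrix_vector_assoc)
    fix s assume s: "s \<in> {0..T}"
    \<comment> \<open>Half of the quadratic term goes to each side. As \<open>p s\<close> and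
      \<open>c s\<close> are symmetric, the remainder is exactly \<open>b s\<close>.\<close>
    define G where "G = a s + (\<phi> s / 2) *\<^sub>R (p s ** c s)"
    have "transpose G = transpose (a s) + (\<phi> s / 2) *\<^sub>R (c s ** p s)"
      by (simp add: G_def transpose_simps sym[OF s] c_sym[OF s])
    then show "f s = b s - (G ** p s + p s ** transpose G)"
      unfolding f_eq[OF s] G_def by (simp add: matrix_distribs) (simp add: vec_eq_iff field_simps)
    show "norm G \<le> na + r * nc" unfolding G_def
    proof (intro norm_add_le a_le s)
      have "norm ((1/2) *\<^sub>R (p s ** c s)) \<le> norm (p s ** c s)" by simp
      also have "\<dots> \<le> r * nc" by (intro norm_matrix_mult_le r c_le s)
      finally have "norm ((1/2) *\<^sub>R (p s ** c s)) \<le> r * nc" .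
      from cp[OF s this] show "norm ((\<phi> s / 2) *\<^sub>R (p s ** c s)) \<le> r * nc" by simp
    qed
  qed
  \<comment> \<open>The barrier \<open>\<kappa>\<close> dominates \<open>p\<close> when its rate
    absorbs \<open>b\<close>, by \<open>nb\<close> since \<open>\<kappa>\<close> is at least 1, and
    \<open>a\<close> with its transpose, by \<open>2 * na\<close>. The quadratic term stays in
    \<open>R\<close>, where it is positive, so neither \<open>c\<close> nor \<open>\<phi>\<close>
    enters the rate. At time \<open>T\<close> the difference is \<open>1 - m\<close> times the
    identity, whence the condition \<open>m \<le> 1\<close>.\<close>
  define k where "k = nb + 2 * na"
  define \<kappa> where "\<kappa> s = exp (k * (T - s))" for s
  have "k \<ge> 0" using bounds_nonneg by (simp add: k_def)
  have \<kappa>: "1 \<le> \<kappa> s" "\<kappa> s \<le> exp (k * T)" if "s \<in> {0..T}" for s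
    using that \<open>k \<ge> 0\<close> by (auto simp: \<kappa>_def intro: mult_left_mono)
  have "\<kappa> t *\<^sub>R mat 1 - p t \<in> psd_mats"
  proof (rule lyapunov_psd[where f="\<lambda>s. (k * \<kappa> s) *\<^sub>R mat 1 - f s" and G=a and P="(1 - m) *\<^sub>R mat 1"
        and R="\<lambda>s. (k * \<kappa> s) *\<^sub>R mat 1 - b s + \<kappa> s *\<^sub>R (a s + transpose (a s)) + \<phi> s *\<^sub>R (p s ** c s ** p s)"
        and K="k * exp (k * T) * norm (mat 1 :: real^'n^'n) + K", OF _ _ _ _ _ _ a_le _ t])
    have I: "((\<lambda>s. (k * \<kappa> s) *\<^sub>R mat 1 :: real^'n^'n) has_integral (\<kappa> s - 1) *\<^sub>R mat 1) {s..T}" if "s \<in> {0..T}" for s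
      unfolding \<kappa>_def using has_integral_exp_scaleR[of s T k] that by auto
    have fI: "f integrable_on {s..T}" if "s \<in> {0..T}" for s
      using integrable_subinterval_real[OF f, of s T] that by auto
    show "(\<lambda>s. (k * \<kappa> s) *\<^sub>R mat 1 - f s) integrable_on {0..T}"
      using I[of 0] f T_nonneg by (intro integrable_diff) auto
    show "(1 - m) *\<^sub>R mat 1 \<in> (psd_mats :: (real^'n^'n) set)"
      using m by (intro psd_matsI) (auto simp: transpose_simps simp flip: scaleR_matrix_vector_assoc)
    fix s assume s: "s \<in> {0..T}"
    show "\<kappa> s *\<^sub>R mat 1 - p s = (1 - m) *\<^sub>R mat 1 + integral {s..T} (\<lambda>s. (k * \<kappa> s) *\<^sub>R mat 1 - f s)"
      using integral_diff[OF has_integral_integrable[OF I[OF s]] fI[OF s]] integral_unique[OF I[OF s]]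
      by (simp add: p[OF s] algebra_simps)
    show "transpose (\<kappa> s *\<^sub>R mat 1 - p s) = \<kappa> s *\<^sub>R mat 1 - p s"
      by (simp add: transpose_simps sym[OF s])
    show "(k * \<kappa> s) *\<^sub>R mat 1 - f s =
        (k * \<kappa> s) *\<^sub>R mat 1 - b s + \<kappa> s *\<^sub>R (a s + transpose (a s)) + \<phi> s *\<^sub>R (p s ** c s ** p s) -
        (a s ** (\<kappa> s *\<^sub>R mat 1 - p s) + (\<kappa> s *\<^sub>R mat 1 - p s) ** transpose (a s))"
      unfolding f_eq[OF s] by (simp add: matrix_distribs) (simp add: algebra_simps)
    show "norm ((k * \<kappa> s) *\<^sub>R mat 1 - f s) \<le> k * exp (k * T) * norm (mat 1 :: real^'n^'n) + K"
      using \<kappa>[OF s] \<open>k \<ge> 0\<close> by (intro norm_diff_le K s) (auto intro!: mult_mono)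
    show "(k * \<kappa> s) *\<^sub>R mat 1 - b s + \<kappa> s *\<^sub>R (a s + transpose (a s)) + \<phi> s *\<^sub>R (p s ** c s ** p s) \<in> psd_mats"
    proof (rule psd_matsI)
      show "transpose ((k * \<kappa> s) *\<^sub>R mat 1 - b s + \<kappa> s *\<^sub>R (a s + transpose (a s)) + \<phi> s *\<^sub>R (p s ** c s ** p s)) =
          (k * \<kappa> s) *\<^sub>R mat 1 - b s + \<kappa> s *\<^sub>R (a s + transpose (a s)) + \<phi> s *\<^sub>R (p s ** c s ** p s)"
        by (simp add: transpose_simps sym[OF s] c_sym[OF s] psd_matsD(1)[OF b_psd[OF s]] matrix_mul_assoc add.commute)
      fix x :: "real^'n"
      have nx: "norm x * norm x = x \<bullet> x" by (simp add: norm_eq_sqrt_inner)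
      have "x \<bullet> (b s *v x) \<le> norm (b s) * (norm x * norm x)" by (rule quadratic_form_le)
      also have "\<dots> \<le> (\<kappa> s * nb) * (x \<bullet> x)"
        unfolding nx using \<kappa>[OF s] b_le[OF s] mult_right_mono[of 1 "\<kappa> s" nb] bounds_nonneg
        by (intro mult_right_mono) auto
      finally have 1: "x \<bullet> (b s *v x) \<le> \<kappa> s * nb * (x \<bullet> x)" .
      have "- (na * (x \<bullet> x)) \<le> x \<bullet> (a s *v x)"
        using quadratic_form_le(2)[of "a s" x x] mult_right_mono[OF a_le[OF s], of "x \<bullet> x"] by (simp add: nx)
      then have "\<kappa> s * (- (na * (x \<bullet> x))) \<le> \<kappa> s * (x \<bullet> (a s *v x))"
        using \<kappa>[OF s] by (intro mult_left_mono) auto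
      moreover have "0 \<le> (p s *v x) \<bullet> (c s *v (p s *v x))"
        using c_psd[OF s] by (rule psd_matsD)
      then have "0 \<le> \<phi> s * (x \<bullet> ((p s ** c s ** p s) *v x))"
        using \<phi>[OF s] sym[OF s] by (simp add: matrix_vector_mult_mult inner_sym_mats sym_mats_def)
      moreover have "x \<bullet> (transpose (a s) *v x) = x \<bullet> (a s *v x)"
        by (simp add: inner_transpose_right inner_commute)
      ultimately show "0 \<le> x \<bullet> (((k * \<kappa> s) *\<^sub>R mat 1 - b s + \<kappa> s *\<^sub>R (a s + transpose (a s)) + \<phi> s *\<^sub>R (p s ** c s ** p s)) *v x)"
        using 1
        by (simp add: k_def matrix_vector_mult_add_rdistrib matrix_vector_mult_diff_rdistrib inner_add_right
            inner_diff_right algebra_simps flip: scaleR_matrix_vector_assoc)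
    qed
  qed
  from psd_matsD(2)[OF this, of x]
  show "x \<bullet> (p t *v x) \<le> exp ((nb + 2 * na) * (T - t)) * (norm x)\<^sup>2"
    by (simp add: \<kappa>_def k_def matrix_vector_mult_diff_rdistrib inner_diff_right power2_norm_eq_inner
        flip: scaleR_matrix_vector_assoc)
qed


lemma norm_rhs_le:
  assumes "s \<in> {0..T}" "norm q \<le> r"
  shows "norm (- riccati_rhs (a s) (b s) (c s) q) \<le> r * nc * r + na * r + r * na + nb"
  using norm_riccati_rhs_le[OF a_le b_le c_le assms(2)] assms(1) by simp

lemma rhs_measurable:
  assumes "p \<in> borel_measurable (restrict_space borel {0..T})"
  shows "(\<lambda>s. riccati_rhs (a s) (b s) (c s) (p s)) \<in> borel_measurable (restrict_space borel {0..T})"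
  unfolding riccati_rhs_def using a_meas b_meas c_meas assms by measurable

text \<open>The library's Bochner integrals are traded for gauge integrals, whose calculus is richer.\<close>

lemma psd_riccati_solution_iff:
  "psd_riccati_solution T M a b c p \<longleftrightarrow>
     p \<in> Linf {0..T} psd_mats \<and>
     (\<lambda>s. - riccati_rhs (a s) (b s) (c s) (p s)) integrable_on {0..T} \<and>
     (\<forall>t\<in>{0..T}. p t = enat_inv M *\<^sub>R mat 1 + integral {t..T} (\<lambda>s. - riccati_rhs (a s) (b s) (c s) (p s)))"
proof (cases "p \<in> Linf {0..T} psd_mats")
  case True
  then have p: "p \<in> borel_measurable (restrict_space borel {0..T})" and "bounded (p ` {0..T})"
    by (auto simp: Linf_def)
  then obtain r where r: "\<And>t. t \<in> {0..T} \<Longrightarrow> norm (p t) \<le> r"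
    unfolding bounded_iff by blast
  note m = rhs_measurable[OF p] and n = norm_riccati_rhs_le[OF a_le b_le c_le r]
  have "(\<lambda>s. riccati_rhs (a s) (b s) (c s) (p s)) integrable_on {0..T}"
    "set_integrable lborel {0..T} (\<lambda>s. riccati_rhs (a s) (b s) (c s) (p s))"
    using integrable_on_bounded_measurable[OF m n, of 0] set_integrable_bounded_measurable[OF m n, of 0] T_nonneg
    by auto
  moreover have "(LINT s:{t..T}|lborel. riccati_rhs (a s) (b s) (c s) (p s)) =
      integral {t..T} (\<lambda>s. riccati_rhs (a s) (b s) (c s) (p s))" if "t \<in> {0..T}" for t
    using set_lebesgue_integral_eq_integral[OF m n, of t] that by auto
  ultimately show ?thesis
    using True by (simp add: psd_riccati_solution_def integrable_neg_iff)
qed (auto simp: psd_riccati_solution_def)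

lemma
  assumes sol: "psd_riccati_solution T M a b c p"
  shows solution_integrable: "(\<lambda>s. - riccati_rhs (a s) (b s) (c s) (p s)) integrable_on {0..T}"
    and solution_eq: "\<And>t. t \<in> {0..T} \<Longrightarrow>
      p t = enat_inv M *\<^sub>R mat 1 + integral {t..T} (\<lambda>s. - riccati_rhs (a s) (b s) (c s) (p s))"
    and solution_psd: "\<And>t. t \<in> {0..T} \<Longrightarrow> p t \<in> psd_mats"
    and solution_sym: "\<And>t. t \<in> {0..T} \<Longrightarrow> transpose (p t) = p t"
  using sol unfolding psd_riccati_solution_iff by (auto simp: Linf_def psd_matsD(1) Pi_iff)

lemma solution_bounded:
  assumes "psd_riccati_solution T M a b c p"
  obtains r where "\<And>t. t \<in> {0..T} \<Longrightarrow> norm (p t) \<le> r"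
  using assms unfolding psd_riccati_solution_def Linf_def bounded_iff by blast

lemma norm_le_of_form_le:
  fixes p :: "real^'n^'n"
  assumes "p \<in> psd_mats" "\<And>x. x \<bullet> (p *v x) \<le> exp ((nb + 2 * na) * (T - t)) * (norm x)\<^sup>2" "t \<in> {0..T}"
  shows "opnorm p \<le> exp ((nb + 2 * na) * T)"
    and "norm p \<le> real CARD('n) * real CARD('n) * exp ((nb + 2 * na) * T)"
proof -
  have "opnorm p \<le> exp ((nb + 2 * na) * (T - t))"
    by (rule opnorm_psd_le[OF assms(1,2)]) auto
  also have "\<dots> \<le> exp ((nb + 2 * na) * T)"
    using assms(3) bounds_nonneg by (auto intro!: mult_left_mono)
  finally show *: "opnorm p \<le> exp ((nb + 2 * na) * T)" .
  have "real CARD('n) * real CARD('n) * opnorm p \<le> real CARD('n) * real CARD('n) * exp ((nb + 2 * na) * T)"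
    by (intro mult_left_mono *) auto
  with norm_le_opnorm[of p]
  show "norm p \<le> real CARD('n) * real CARD('n) * exp ((nb + 2 * na) * T)" by linarith
qed

lemma
  assumes sol: "psd_riccati_solution T M a b c p" and m: "0 \<le> enat_inv M" "enat_inv M \<le> 1"
    and t: "t \<in> {0..T}"
  shows solution_opnorm_le: "opnorm (p t) \<le> exp ((nb + 2 * na) * T)"
    and solution_norm_le: "norm (p t) \<le> real CARD('n) * real CARD('n) * exp ((nb + 2 * na) * T)"
proof -
  obtain r where r: "\<And>t. t \<in> {0..T} \<Longrightarrow> norm (p t) \<le> r"
    using solution_bounded[OF sol] by blast
  have "x \<bullet> (p t *v x) \<le> exp ((nb + 2 * na) * (T - t)) * (norm x)\<^sup>2" for x
    by (rule damped_bounds(2)[OF solution_eq[OF sol] solution_integrable[OF sol] _ solution_sym[OF sol] r _ m t,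
          where \<phi>="\<lambda>_. 1"]) (auto simp: riccati_rhs_def)
  from norm_le_of_form_le[OF solution_psd[OF sol t] this t]
  show "opnorm (p t) \<le> exp ((nb + 2 * na) * T)"
    "norm (p t) \<le> real CARD('n) * real CARD('n) * exp ((nb + 2 * na) * T)" .
qed

text \<open>The cutoff shrinks a matrix radially, so along a solution of the truncated equation it
  amounts to a scalar factor between 0 and 1 in front of \<open>p ** c ** p\<close>. This is the
  form treated by \<open>damped_bounds\<close>, and the bound obtained there is the radius
  \<open>r\<close> of the cutoff, which forces the factor to be 1.\<close>

lemma solution_exists:
  assumes m: "0 \<le> enat_inv M" "enat_inv M \<le> 1"
  shows "\<exists>p. psd_riccati_solution T M a b c p"
proof -
  define r where "r = real CARD('n) * real CARD('n) * exp ((nb + 2 * na) * T)"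
  have "r > 0" by (simp add: r_def)
  define \<pi> where "\<pi> q = (r / max r (norm q)) *\<^sub>R q" for q :: "real^'n^'n"
  \<comment> \<open>The iteration runs through all matrices. Symmetrising the argument gives
    \<open>F s\<close> symmetric values, hence a symmetric solution, as \<open>damped_bounds\<close>
    demands.\<close>
  define S where "S q = (1/2) *\<^sub>R (q + transpose q)" for q :: "real^'n^'n"
  define F where "F s q = b s - (\<pi> (S q) ** c s ** \<pi> (S q) + a s ** S q + S q ** transpose (a s))" for s q
  have \<pi>_le: "norm (\<pi> q) \<le> r" for q
    using \<open>r > 0\<close> by (auto simp: \<pi>_def field_simps max_def)
  have \<pi>_lip: "norm (\<pi> x - \<pi> y) \<le> 2 * norm (x - y)" for x y
  proof -
    define X where "X = max r (norm x)"
    define Y where "Y = max r (norm y)"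
    have pos: "X > 0" "Y > 0" "r \<le> X" "norm y \<le> Y" and XY: "\<bar>Y - X\<bar> \<le> norm (x - y)"
      using \<open>r > 0\<close> norm_triangle_ineq3[of x y] by (auto simp: X_def Y_def max_def)
    \<comment> \<open>Both \<open>r / X\<close> and \<open>norm y / Y\<close> are at most 1 and
      \<open>X\<close>, \<open>Y\<close> differ by at most \<open>norm (x - y)\<close>, so each
      summand contributes one \<open>norm (x - y)\<close> to the Lipschitz constant 2.\<close>
    have "\<pi> x - \<pi> y = (r / X) *\<^sub>R (x - y) + (r / X * ((Y - X) / Y)) *\<^sub>R y"
    proof -
      have "r / Y = r / X - r / X * ((Y - X) / Y)" using pos by (simp add: field_simps)
      then have "(r / Y) *\<^sub>R y = (r / X) *\<^sub>R y - (r / X * ((Y - X) / Y)) *\<^sub>R y"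
        by (metis scaleR_left.diff)
      then show ?thesis by (simp add: \<pi>_def scaleR_diff_right flip: X_def Y_def)
    qed
    then have "norm (\<pi> x - \<pi> y) \<le> r / X * norm (x - y) + r / X * (\<bar>Y - X\<bar> * (norm y / Y))"
      using pos \<open>r > 0\<close> norm_triangle_ineq[of "(r / X) *\<^sub>R (x - y)" "(r / X * ((Y - X) / Y)) *\<^sub>R y"]
      by (simp add: abs_mult)
    also have "\<dots> \<le> 1 * norm (x - y) + 1 * (norm (x - y) * 1)"
      using pos \<open>r > 0\<close> XY by (intro add_mono mult_mono) auto
    finally show ?thesis by simp
  qed
  have S_lip: "norm (S x - S y) \<le> norm (x - y)" for x y
  proof -
    have "S x - S y = (1/2) *\<^sub>R ((x - y) + transpose (x - y))"
      by (simp add: S_def transpose_simps algebra_simps)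
    then have "norm (S x - S y) = (1/2) * norm ((x - y) + transpose (x - y))" by simp
    also have "norm ((x - y) + transpose (x - y)) \<le> norm (x - y) + norm (x - y)"
      by (intro norm_add_le) (simp_all add: norm_transpose)
    finally show ?thesis by simp
  qed
  have \<pi>S_lip: "norm (\<pi> (S x) - \<pi> (S y)) \<le> 2 * norm (x - y)" for x y
    using \<pi>_lip[of "S x" "S y"] S_lip[of x y] by linarith
  \<comment> \<open>The quadratic term differs by two products, each with a factor
    \<open>r * nc\<close> and a cutoff difference of at most twice the distance, which gives
    \<open>4 * r * nc\<close>. The two linear terms give \<open>2 * na\<close>, and the
    \<open>1\<close> keeps \<open>L\<close> positive.\<close>
  define L where "L = 4 * r * nc + 2 * na + 1"
  have "L > 0" using \<open>r > 0\<close> bounds_nonneg unfolding L_def by (intro add_nonneg_pos add_nonneg_nonneg mult_nonneg_nonneg) auto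
  have F_lip: "norm (F s x - F s y) \<le> L * norm (x - y)" if s: "s \<in> {0..T}" for s x y
  proof -
    let ?x = "\<pi> (S x)" and ?y = "\<pi> (S y)"
    have "norm (F s y - F s x) \<le>
        r * nc * (2 * norm (x - y)) + (2 * norm (x - y)) * nc * r + na * norm (x - y) + norm (x - y) * na"
    proof -
      have "F s y - F s x = ?x ** c s ** (?x - ?y) + (?x - ?y) ** c s ** ?y + a s ** (S x - S y) + (S x - S y) ** transpose (a s)"
        unfolding F_def by (simp add: matrix_distribs)
      then show ?thesis
        using a_le[OF s]
        by (simp only:) (intro norm_add_le norm_matrix_mult_le \<pi>_le \<pi>S_lip S_lip c_le s; simp add: norm_transpose)
    qed
    also have "\<dots> \<le> L * norm (x - y)"
      by (simp add: L_def algebra_simps)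
    finally show ?thesis by (simp add: norm_minus_commute)
  qed
  have cont_S: "continuous_on UNIV S"
    unfolding S_def by (intro continuous_intros linear_continuous_on bounded_linear_transpose)
  have cont_\<pi>: "continuous_on UNIV \<pi>"
    unfolding \<pi>_def using \<open>r > 0\<close> by (intro continuous_intros) (auto simp: max_def)
  have F_meas: "(\<lambda>s. F s (u s)) \<in> borel_measurable (restrict_space borel {0..T})"
    if u: "continuous_on {0..T} u" for u
  proof -
    have "u \<in> borel_measurable (restrict_space borel {0..T})"
      by (rule borel_measurable_continuous_on_restrict[OF u])
    then have Su: "(\<lambda>s. S (u s)) \<in> borel_measurable (restrict_space borel {0..T})"
      by (rule measurable_compose[OF _ borel_measurable_continuous_onI[OF cont_S]])
    then have "(\<lambda>s. \<pi> (S (u s))) \<in> borel_measurable (restrict_space borel {0..T})"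
      by (rule measurable_compose[OF _ borel_measurable_continuous_onI[OF cont_\<pi>]])
    with Su show ?thesis
      unfolding F_def using a_meas b_meas c_meas by measurable
  qed
  have F_int: "(\<lambda>s. F s (u s)) integrable_on {0..T}" if u: "continuous_on {0..T} u" for u
  proof -
    have "bounded (u ` {0..T})" by (intro compact_imp_bounded compact_continuous_image u) auto
    then obtain B where B: "\<And>t. t \<in> {0..T} \<Longrightarrow> norm (u t) \<le> B"
      unfolding bounded_iff by blast
    have "norm (F s (u s)) \<le> nb + L * B" if s: "s \<in> {0..T}" for s
    proof -
      have "norm (F s (u s) - F s 0) \<le> L * norm (u s)" using F_lip[OF s, of "u s" 0] by simp
      also have "\<dots> \<le> L * B" using B[OF s] \<open>L > 0\<close> by (intro mult_left_mono) auto
      finally have "norm (F s (u s) - b s) \<le> L * B" by (simp add: F_def S_def \<pi>_def)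
      with norm_add_le[OF b_le[OF s] this] show ?thesis by simp
    qed
    then show ?thesis
      using integrable_on_bounded_measurable[OF F_meas[OF u], of _ 0] T_nonneg by auto
  qed
  obtain u where u: "continuous_on {0..T} u"
    and u_eq: "\<And>t. t \<in> {0..T} \<Longrightarrow> u t = enat_inv M *\<^sub>R mat 1 + integral {t..T} (\<lambda>s. F s (u s))"
    using backward_picard[OF T_nonneg \<open>L > 0\<close> F_lip F_int, of "enat_inv M *\<^sub>R mat 1"] by blast
  have F_sym: "transpose (F s q) = F s q" if s: "s \<in> {0..T}" for s q
  proof -
    have S: "transpose (S q) = S q" by (simp add: S_def transpose_simps add.commute)
    have "transpose (\<pi> (S q)) = \<pi> (S q)" by (simp add: \<pi>_def transpose_simps S)
    with S show ?thesis
      by (simp add: F_def transpose_simps matrix_mul_assoc add_ac psd_matsD(1)[OF b_psd[OF s]] psd_matsD(1)[OF c_psd[OF s]])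
  qed
  have sym: "transpose (u t) = u t" if t: "t \<in> {0..T}" for t
  proof -
    have "transpose (integral {t..T} (\<lambda>s. F s (u s))) = integral {t..T} (\<lambda>s. transpose (F s (u s)))"
      using integral_linear[OF _ bounded_linear_transpose, of "\<lambda>s. F s (u s)" "{t..T}"]
        integrable_subinterval_real[OF F_int[OF u], of t T] t by (simp add: o_def)
    also have "\<dots> = integral {t..T} (\<lambda>s. F s (u s))"
      using t F_sym by (intro integral_cong) auto
    finally show ?thesis using u_eq[OF t] by (simp add: transpose_simps)
  qed
  have S_u: "S (u t) = u t" if "t \<in> {0..T}" for t
    using sym[OF that] by (simp add: S_def flip: scaleR_2)
  obtain B where B: "\<And>t. t \<in> {0..T} \<Longrightarrow> norm (u t) \<le> B"
    using compact_imp_bounded[OF compact_continuous_image[OF u compact_Icc]] unfolding bounded_iff by blast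
  \<comment> \<open>Squared because the cutoff acts on both factors around \<open>c\<close>.\<close>
  define \<phi> where "\<phi> t = (r / max r (norm (u t)))\<^sup>2" for t
  have \<phi>: "0 \<le> \<phi> t \<and> \<phi> t \<le> 1" for t
    using \<open>r > 0\<close> by (auto simp: \<phi>_def intro!: power_le_one)
  have F_eq: "F s (u s) = b s - (\<phi> s *\<^sub>R (u s ** c s ** u s) + a s ** u s + u s ** transpose (a s))"
    if "s \<in> {0..T}" for s
    unfolding F_def S_u[OF that] by (simp add: \<pi>_def \<phi>_def power2_eq_square matrix_distribs)
  have bounds: "u t \<in> psd_mats" "x \<bullet> (u t *v x) \<le> exp ((nb + 2 * na) * (T - t)) * (norm x)\<^sup>2"
    if t: "t \<in> {0..T}" for t x
    using damped_bounds[OF u_eq F_int[OF u] F_eq sym B \<phi> m t] by auto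
  have "norm (u t) \<le> r" if t: "t \<in> {0..T}" for t
    unfolding r_def by (rule norm_le_of_form_le(2)[OF bounds(1)[OF t] bounds(2)[OF t] t])
  then have "\<phi> t = 1" if "t \<in> {0..T}" for t
    using that \<open>r > 0\<close> by (simp add: \<phi>_def max_absorb1)
  then have F_rhs: "F s (u s) = - riccati_rhs (a s) (b s) (c s) (u s)" if "s \<in> {0..T}" for s
    using that by (simp add: F_eq riccati_rhs_def)
  have "psd_riccati_solution T M a b c u"
    unfolding psd_riccati_solution_iff
  proof (intro conjI ballI)
    show "u \<in> Linf {0..T} psd_mats"
      using bounds(1) borel_measurable_continuous_on_restrict[OF u] B
      by (auto simp: Linf_def bounded_iff intro: exI[of _ B])
    show "(\<lambda>s. - riccati_rhs (a s) (b s) (c s) (u s)) integrable_on {0..T}"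
      using F_int[OF u] by (rule integrable_eq) (simp add: F_rhs)
    fix t assume t: "t \<in> {0..T}"
    have "integral {t..T} (\<lambda>s. F s (u s)) = integral {t..T} (\<lambda>s. - riccati_rhs (a s) (b s) (c s) (u s))"
      using t by (intro integral_cong F_rhs) auto
    with u_eq[OF t] show "u t = enat_inv M *\<^sub>R mat 1 + integral {t..T} (\<lambda>s. - riccati_rhs (a s) (b s) (c s) (u s))"
      by simp
  qed
  then show ?thesis by blast
qed


text \<open>Once a bound \<open>r\<close> on \<open>p\<close> is known, the factor
  \<open>p ** c\<close> may be treated as part of a linear coefficient. The barrier
  \<open>\<kappa>\<close> starts from the same terminal value as \<open>p\<close> and decays
  backwards at a rate \<open>k\<close> that dominates the form of \<open>a + transpose a\<close> by
  \<open>2 * na\<close> and that of the symmetric part of \<open>p ** c\<close> by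
  \<open>r * nc\<close>, so that the remainder is positive.\<close>

lemma solution_ge:
  assumes sol: "psd_riccati_solution T M a b c p"
    and r: "\<And>t. t \<in> {0..T} \<Longrightarrow> norm (p t) \<le> r"
    and m: "0 \<le> enat_inv M" and t: "t \<in> {0..T}"
  shows "(enat_inv M * exp (- ((2 * na + r * nc) * T))) *\<^sub>R mat 1 \<preceq> p t"
proof -
  note p_int = solution_integrable[OF sol] and p_eq = solution_eq[OF sol] and sym = solution_sym[OF sol]
  have "r \<ge> 0" using r[OF t] norm_ge_zero order_trans by blast
  define K where "K = r * nc * r + na * r + r * na + nb"
  define k where "k = 2 * na + r * nc"
  define m where "m = enat_inv M"
  define \<kappa> where "\<kappa> s = m * exp (- k * (T - s))" for s
  let ?f = "\<lambda>s. - riccati_rhs (a s) (b s) (c s) (p s) + (k * \<kappa> s) *\<^sub>R mat 1"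
  let ?G = "\<lambda>s. a s + (1/2) *\<^sub>R (p s ** c s)"
  let ?R = "\<lambda>s. b s + \<kappa> s *\<^sub>R (k *\<^sub>R mat 1 - (a s + transpose (a s)) - (1/2) *\<^sub>R (p s ** c s + c s ** p s))"
  have "k \<ge> 0" using bounds_nonneg \<open>r \<ge> 0\<close> by (simp add: k_def)
  have "m \<ge> 0" using m by (simp add: m_def)
  have \<kappa>: "0 \<le> \<kappa> s" "\<kappa> s \<le> m" if "s \<in> {0..T}" for s
    using that \<open>k \<ge> 0\<close> \<open>m \<ge> 0\<close> by (auto simp: \<kappa>_def intro!: mult_left_le)
  have c_sym: "transpose (c s) = c s" if "s \<in> {0..T}" for s
    using c_psd[OF that] by (rule psd_matsD)
  have "p t - \<kappa> t *\<^sub>R mat 1 \<in> psd_mats"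
  proof (rule lyapunov_psd[where f="?f" and G="?G" and R="?R" and P=0 and g="na + r * nc"
        and K="K + k * m * norm (mat 1 :: real^'n^'n)", OF _ _ _ _ _ _ _ _ t])
    have I: "((\<lambda>s. (k * \<kappa> s) *\<^sub>R mat 1 :: real^'n^'n) has_integral (m - \<kappa> s) *\<^sub>R mat 1) {s..T}" if "s \<in> {0..T}" for s
      using has_integral_cmul[OF has_integral_exp_scaleR[of s T "- k" "mat 1 :: real^'n^'n"], of "- m"] that
      by (simp add: \<kappa>_def algebra_simps)
    have fI: "(\<lambda>s. - riccati_rhs (a s) (b s) (c s) (p s)) integrable_on {s..T}" if "s \<in> {0..T}" for s
      using integrable_subinterval_real[OF p_int, of s T] that by auto
    show "?f integrable_on {0..T}"
      using I[of 0] fI[of 0] T_nonneg by (intro integrable_add) auto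
    show "(0 :: real^'n^'n) \<in> psd_mats" by (auto intro: psd_matsI)
    fix s assume s: "s \<in> {0..T}"
    have "integral {s..T} ?f = integral {s..T} (\<lambda>s. - riccati_rhs (a s) (b s) (c s) (p s)) + (m - \<kappa> s) *\<^sub>R mat 1"
      by (subst Henstock_Kurzweil_Integration.integral_add[OF fI[OF s] has_integral_integrable[OF I[OF s]]])
         (simp only: integral_unique[OF I[OF s]])
    then show "p s - \<kappa> s *\<^sub>R mat 1 = 0 + integral {s..T} ?f"
      by (simp only: p_eq[OF s] m_def scaleR_diff_left) simp
    show "transpose (p s - \<kappa> s *\<^sub>R mat 1) = p s - \<kappa> s *\<^sub>R mat 1"
      by (simp add: transpose_simps sym[OF s])
    show "?f s = ?R s - (?G s ** (p s - \<kappa> s *\<^sub>R mat 1) + (p s - \<kappa> s *\<^sub>R mat 1) ** transpose (?G s))"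
      by (simp add: riccati_rhs_def transpose_simps sym[OF s] c_sym[OF s] matrix_distribs)
         (simp add: vec_eq_iff field_simps)
    show "norm (?f s) \<le> K + k * m * norm (mat 1 :: real^'n^'n)"
      unfolding K_def using \<kappa>[OF s] \<open>k \<ge> 0\<close>
      by (intro norm_add_le norm_rhs_le r s) (auto intro!: mult_mono)
    show "norm (?G s) \<le> na + r * nc"
    proof (intro norm_add_le a_le s)
      have "norm ((1/2) *\<^sub>R (p s ** c s)) \<le> norm (p s ** c s)" by simp
      also have "\<dots> \<le> r * nc" by (intro norm_matrix_mult_le r c_le s)
      finally show "norm ((1/2) *\<^sub>R (p s ** c s)) \<le> r * nc" .
    qed
    show "?R s \<in> psd_mats"
    proof (rule psd_matsI)
      show "transpose (?R s) = ?R s"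
        by (simp add: transpose_simps sym[OF s] c_sym[OF s] psd_matsD(1)[OF b_psd[OF s]] add.commute)
      fix x :: "real^'n"
      have nx: "norm x * norm x = x \<bullet> x" by (simp add: norm_eq_sqrt_inner)
      have "x \<bullet> (a s *v x) \<le> na * (x \<bullet> x)"
        using quadratic_form_le(1)[of x "a s" x] mult_right_mono[OF a_le[OF s], of "x \<bullet> x"] by (simp add: nx)
      moreover have "x \<bullet> ((p s ** c s) *v x) \<le> r * nc * (x \<bullet> x)"
        using quadratic_form_le(1)[of x "p s ** c s" x]
          mult_right_mono[OF norm_matrix_mult_le[OF r[OF s] c_le[OF s]], of "x \<bullet> x"] by (simp add: nx)
      moreover have "x \<bullet> (transpose (a s) *v x) = x \<bullet> (a s *v x)"
        by (simp add: inner_transpose_right inner_commute)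
      moreover have "x \<bullet> ((c s ** p s) *v x) = x \<bullet> ((p s ** c s) *v x)"
        using inner_transpose_right[of x "p s ** c s" x]
        by (simp add: transpose_simps sym[OF s] c_sym[OF s] inner_commute)
      ultimately have "0 \<le> x \<bullet> ((k *\<^sub>R mat 1 - (a s + transpose (a s)) - (1/2) *\<^sub>R (p s ** c s + c s ** p s)) *v x)"
        by (simp add: k_def matrix_vector_mult_add_rdistrib matrix_vector_mult_diff_rdistrib inner_add_right
            inner_diff_right algebra_simps flip: scaleR_matrix_vector_assoc)
      then show "0 \<le> x \<bullet> (?R s *v x)"
        using psd_matsD(2)[OF b_psd[OF s], of x] \<kappa>[OF s]
        by (simp add: matrix_vector_mult_add_rdistrib inner_add_right flip: scaleR_matrix_vector_assoc)
    qed
  qed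
  note psd = psd_matsD(2)[OF this]
  have "m * exp (- (k * T)) \<le> \<kappa> t"
    unfolding \<kappa>_def using t \<open>k \<ge> 0\<close> \<open>m \<ge> 0\<close> by (auto intro!: mult_left_mono)
  then have "m * exp (- (k * T)) * (x \<bullet> x) \<le> x \<bullet> (p t *v x)" for x
    using psd[of x] mult_right_mono[of "m * exp (- (k * T))" "\<kappa> t" "x \<bullet> x"]
    by (simp add: matrix_vector_mult_diff_rdistrib inner_diff_right flip: scaleR_matrix_vector_assoc)
  then show ?thesis
    by (intro loewner_leI) (simp_all add: transpose_simps sym[OF t] k_def m_def flip: scaleR_matrix_vector_assoc)
qed

end

text \<open>The identity \<open>p c p - q c q = ((p + q) c (p - q) + (p - q) c (p + q)) / 2\<close>
  makes the difference of the solutions satisfy a linear equation whose \<open>G\<close> contains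
  the mean of \<open>p\<close> and \<open>q\<close>. What remains is the difference of the two
  right-hand sides at the same matrix \<open>p s\<close>, and so the ordering is asked for along
  \<open>p\<close> only. Uniqueness is the case of equal coefficients, used in both
  directions.\<close>

lemma riccati_comparison:
  fixes p q :: "real \<Rightarrow> real^'n^'n"
  assumes coef: "riccati_coefficients T na nb nc a b c" and coef': "riccati_coefficients T na nb nc a' b' c'"
    and p: "psd_riccati_solution T M a b c p" and q: "psd_riccati_solution T M' a' b' c' q"
    and M: "enat_inv M' \<le> enat_inv M"
    and le: "\<And>s x. s \<in> {0..T} \<Longrightarrow>
      x \<bullet> (riccati_rhs (a s) (b s) (c s) (p s) *v x) \<le> x \<bullet> (riccati_rhs (a' s) (b' s) (c' s) (p s) *v x)"
    and t: "t \<in> {0..T}"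
  shows "q t \<preceq> p t"
proof -
  interpret riccati_coefficients T na nb nc a b c by fact
  interpret q: riccati_coefficients T na nb nc a' b' c' by fact
  obtain r1 where r1: "\<And>t. t \<in> {0..T} \<Longrightarrow> norm (p t) \<le> r1"
    using solution_bounded[OF p] by blast
  obtain r2 where r2: "\<And>t. t \<in> {0..T} \<Longrightarrow> norm (q t) \<le> r2"
    using q.solution_bounded[OF q] by blast
  let ?H = "\<lambda>s. - riccati_rhs (a s) (b s) (c s) (p s)" and ?H' = "\<lambda>s. - riccati_rhs (a' s) (b' s) (c' s) (q s)"
  let ?R = "\<lambda>s. riccati_rhs (a' s) (b' s) (c' s) (p s) - riccati_rhs (a s) (b s) (c s) (p s)"
  let ?G = "\<lambda>s. a' s + (1/2) *\<^sub>R ((p s + q s) ** c' s)"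
  show ?thesis unfolding loewner_le_def
  proof (rule lyapunov_psd[where f="\<lambda>s. ?H s - ?H' s" and G="?G" and R="?R" and T=T
        and P="(enat_inv M - enat_inv M') *\<^sub>R mat 1" and g="na + (r1 + r2) * nc"
        and K="(r1 * nc * r1 + na * r1 + r1 * na + nb) + (r2 * nc * r2 + na * r2 + r2 * na + nb)", OF _ _ _ _ _ _ _ _ t])
    note I = solution_integrable[OF p] q.solution_integrable[OF q]
    show "(\<lambda>s. ?H s - ?H' s) integrable_on {0..T}"
      by (intro integrable_diff I)
    show "(enat_inv M - enat_inv M') *\<^sub>R mat 1 \<in> (psd_mats :: (real^'n^'n) set)"
      using M by (intro psd_matsI) (auto simp: transpose_simps simp flip: scaleR_matrix_vector_assoc)
    fix s assume s: "s \<in> {0..T}"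
    note sym = solution_sym[OF p s] q.solution_sym[OF q s] and c_sym = psd_matsD(1)[OF c_psd[OF s]] psd_matsD(1)[OF q.c_psd[OF s]]
      and b_sym = psd_matsD(1)[OF b_psd[OF s]] psd_matsD(1)[OF q.b_psd[OF s]]
    have "integral {s..T} (\<lambda>s. ?H s - ?H' s) = integral {s..T} ?H - integral {s..T} ?H'"
      using s by (intro Henstock_Kurzweil_Integration.integral_diff integrable_subinterval_real[OF I(1)] integrable_subinterval_real[OF I(2)]) auto
    then show "p s - q s = (enat_inv M - enat_inv M') *\<^sub>R mat 1 + integral {s..T} (\<lambda>s. ?H s - ?H' s)"
      by (simp only: solution_eq[OF p s] q.solution_eq[OF q s] scaleR_diff_left) simp
    show "transpose (p s - q s) = p s - q s"
      by (simp add: transpose_simps sym)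
    show "?H s - ?H' s = ?R s - (?G s ** (p s - q s) + (p s - q s) ** transpose (?G s))"
      by (simp add: riccati_rhs_def transpose_simps sym c_sym matrix_distribs)
         (simp add: vec_eq_iff field_simps)
    show "?R s \<in> psd_mats"
      using le[OF s] riccati_rhs_sym[OF b_sym(1) c_sym(1) sym(1)] riccati_rhs_sym[OF b_sym(2) c_sym(2) sym(1)]
      by (intro psd_matsI) (simp_all add: transpose_simps matrix_vector_mult_diff_rdistrib inner_diff_right)
    show "norm (?G s) \<le> na + (r1 + r2) * nc"
    proof (intro norm_add_le q.a_le s)
      have "norm ((1/2) *\<^sub>R ((p s + q s) ** c' s)) \<le> norm ((p s + q s) ** c' s)" by simp
      also have "\<dots> \<le> (r1 + r2) * nc" by (intro norm_matrix_mult_le norm_add_le r1 r2 q.c_le s)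
      finally show "norm ((1/2) *\<^sub>R ((p s + q s) ** c' s)) \<le> (r1 + r2) * nc" .
    qed
    show "norm (?H s - ?H' s) \<le> (r1 * nc * r1 + na * r1 + r1 * na + nb) + (r2 * nc * r2 + na * r2 + r2 * na + nb)"
      by (intro norm_diff_le norm_rhs_le q.norm_rhs_le r1 r2 s)
  qed
qed

text \<open>The difference is positive semi-definite with vanishing form, so its operator norm is 0
  by \<open>opnorm_psd_le\<close>.\<close>

lemma loewner_antisym: "A \<preceq> B \<Longrightarrow> B \<preceq> A \<Longrightarrow> A = (B :: real^'n^'n)"
proof -
  assume AB: "A \<preceq> B" and BA: "B \<preceq> A"
  have "x \<bullet> ((B - A) *v x) = 0" for x
    using loewner_leD[OF AB, of x] loewner_leD[OF BA, of x]
    by (simp add: matrix_vector_mult_diff_rdistrib inner_diff_right)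
  then have "opnorm (B - A) \<le> 0"
    using AB by (intro opnorm_psd_le) (auto simp: loewner_le_def)
  then have "norm (B - A) \<le> 0"
    using norm_le_opnorm[of "B - A"] mult_nonneg_nonpos[of "real CARD('n) * real CARD('n)" "opnorm (B - A)"] by (simp del: norm_le_zero_iff)
  then show "A = B" by simp
qed

lemma (in riccati_coefficients) solution_unique:
  assumes "psd_riccati_solution T M a b c p" "psd_riccati_solution T M a b c q" "t \<in> {0..T}"
  shows "q t = p t"
  using assms by (intro loewner_antisym riccati_comparison[OF riccati_coefficients_axioms riccati_coefficients_axioms]) auto

section \<open>The coefficients\<close>

text \<open>One second countable factor suffices: an open \<open>W\<close> is the union over a countable base of the
  rectangles \<open>U \<times> V\<close> with \<open>V\<close> the largest open set such that \<open>U \<times> V \<subseteq> W\<close>.\<close>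

lemma measurable_pair_borel:
  "(\<lambda>x. x) \<in> restrict_space borel X \<Otimes>\<^sub>M restrict_space borel Y \<rightarrow>\<^sub>M
     restrict_space (borel :: ('x::second_countable_topology \<times> 'y::topological_space) measure) (X \<times> Y)"
proof (rule measurable_restrict_space2)
  show "(\<lambda>x. x) \<in> space (restrict_space borel X \<Otimes>\<^sub>M restrict_space borel Y) \<rightarrow> X \<times> Y"
    by (auto simp: space_pair_measure space_restrict_space)
  show "(\<lambda>x. x) \<in> borel_measurable (restrict_space (borel :: 'x measure) X \<Otimes>\<^sub>M restrict_space (borel :: 'y measure) Y)"
  proof (rule borel_measurableI)
    fix W :: "('x \<times> 'y) set" assume W: "open W"
    obtain \<B> :: "'x set set" where \<B>: "countable \<B>" "topological_basis \<B>"
      using ex_countable_basis by blast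
    define V where "V U = \<Union>{V. open V \<and> U \<times> V \<subseteq> W}" for U
    have "W = (\<Union>U\<in>\<B>. U \<times> V U)"
    proof (intro equalityI subsetI)
      fix z assume "z \<in> W"
      then obtain A B where AB: "open A" "open B" "z \<in> A \<times> B" "A \<times> B \<subseteq> W"
        using open_prod_elim[OF W] by metis
      then obtain U where "U \<in> \<B>" "fst z \<in> U" "U \<subseteq> A"
        using topological_basisE[OF \<B>(2) AB(1), of "fst z"] by (metis mem_Times_iff)
      with AB show "z \<in> (\<Union>U\<in>\<B>. U \<times> V U)"
        by (auto simp: V_def intro!: bexI[of _ U] exI[of _ B])
    qed (auto simp: V_def)
    then have "(\<lambda>x. x) -` W \<inter> space (restrict_space borel X \<Otimes>\<^sub>M restrict_space borel Y) =
        (\<Union>U\<in>\<B>. (X \<inter> U) \<times> (Y \<inter> V U))"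
      by (auto simp: space_pair_measure space_restrict_space)
    also have "\<dots> \<in> sets (restrict_space borel X \<Otimes>\<^sub>M restrict_space borel Y)"
    proof (intro sets.countable_UN'' \<B> pair_measureI)
      fix U assume "U \<in> \<B>"
      then have "open U" by (rule topological_basis_open[OF \<B>(2)])
      moreover have "open (V U)" by (auto simp: V_def)
      ultimately show "X \<inter> U \<in> sets (restrict_space borel X)" "Y \<inter> V U \<in> sets (restrict_space borel Y)"
        by (auto simp: sets_restrict_space)
    qed
    finally show "(\<lambda>x. x) -` W \<inter> space (restrict_space borel X \<Otimes>\<^sub>M restrict_space borel Y) \<in>
        sets (restrict_space borel X \<Otimes>\<^sub>M restrict_space borel Y)" .
  qed
qed

text \<open>Pushing \<open>K x\<close> forward along \<open>y \<mapsto> (x, y)\<close> moves the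
  dependence on \<open>x\<close> from the integrand to the measure: \<open>f\<close> is then
  integrated against a measurable family of measures on the product.\<close>

lemma measurable_kernel_integral:
  fixes f :: "'x \<times> 'y \<Rightarrow> 'b::{banach, second_countable_topology}"
  assumes f: "f \<in> borel_measurable (M \<Otimes>\<^sub>M N)" and K: "K \<in> M \<rightarrow>\<^sub>M prob_algebra N"
  shows "(\<lambda>x. \<integral>y. f (x, y) \<partial>K x) \<in> borel_measurable M"
proof -
  have K': "K \<in> M \<rightarrow>\<^sub>M subprob_algebra N"
    using K by (rule measurable_prob_algebraD)
  have "(\<lambda>x. distr (K x) (M \<Otimes>\<^sub>M N) (\<lambda>y. (x, y))) \<in> M \<rightarrow>\<^sub>M subprob_algebra (M \<Otimes>\<^sub>M N)"
    by (rule measurable_distr2[OF _ K']) measurable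
  from measurable_compose[OF this integral_measurable_subprob_algebra[OF f]]
  have "(\<lambda>x. integral\<^sup>L (distr (K x) (M \<Otimes>\<^sub>M N) (\<lambda>y. (x, y))) f) \<in> borel_measurable M" .
  moreover have "integral\<^sup>L (distr (K x) (M \<Otimes>\<^sub>M N) (\<lambda>y. (x, y))) f = (\<integral>y. f (x, y) \<partial>K x)" if "x \<in> space M" for x
  proof (rule integral_distr[OF _ f])
    have "sets (K x) = sets N"
      using measurable_space[OF K' that] by (simp add: space_subprob_algebra)
    with that show "(\<lambda>y. (x, y)) \<in> K x \<rightarrow>\<^sub>M M \<Otimes>\<^sub>M N"
      by (simp cong: measurable_cong_sets)
  qed
  ultimately show ?thesis by (simp cong: measurable_cong)
qed

section \<open>Operator norm and positivity under sums, products and integrals\<close>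

lemma opnorm_mult_le:
  fixes A :: "real^'n^'m" and B :: "real^'k^'n"
  assumes "opnorm A \<le> r" "opnorm B \<le> s"
  shows "opnorm (A ** B) \<le> r * s"
proof -
  have nn: "0 \<le> r" "0 \<le> s" using assms opnorm_nonneg order_trans by blast+
  show ?thesis
  proof (rule opnorm_le)
    fix x :: "real^'k"
    have "norm ((A ** B) *v x) \<le> opnorm A * norm (B *v x)"
      unfolding matrix_vector_mult_mult by (rule norm_mult_le_opnorm)
    also have "\<dots> \<le> r * (opnorm B * norm x)"
      using nn by (intro mult_mono assms norm_mult_le_opnorm) auto
    also have "\<dots> \<le> r * (s * norm x)"
      using nn by (intro mult_left_mono mult_right_mono assms) auto
    finally show "norm ((A ** B) *v x) \<le> r * s * norm x" by simp
  qed (use nn in auto)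
qed

lemma opnorm_add_le:
  fixes A :: "real^'n^'m"
  assumes "opnorm A \<le> r" "opnorm B \<le> s"
  shows "opnorm (A + B) \<le> r + s"
proof (rule opnorm_le)
  show "0 \<le> r + s" using assms opnorm_nonneg[of A] opnorm_nonneg[of B] by linarith
  fix x :: "real^'n"
  have "norm ((A + B) *v x) \<le> norm (A *v x) + norm (B *v x)"
    unfolding matrix_vector_mult_add_rdistrib by (rule norm_triangle_ineq)
  also have "\<dots> \<le> opnorm A * norm x + opnorm B * norm x"
    by (intro add_mono norm_mult_le_opnorm)
  also have "\<dots> \<le> r * norm x + s * norm x"
    by (intro add_mono mult_right_mono assms) auto
  finally show "norm ((A + B) *v x) \<le> (r + s) * norm x" by (simp add: distrib_right)
qed

lemma opnorm_scaleR_le: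
  fixes A :: "real^'n^'m"
  assumes "opnorm A \<le> r" "\<bar>k\<bar> \<le> l"
  shows "opnorm (k *\<^sub>R A) \<le> l * r"
proof (rule opnorm_le)
  have "0 \<le> r" using assms opnorm_nonneg order_trans by blast
  then show "0 \<le> l * r" using assms by auto
  fix x :: "real^'n"
  have "norm ((k *\<^sub>R A) *v x) = \<bar>k\<bar> * norm (A *v x)"
    by (simp flip: scaleR_matrix_vector_assoc)
  also have "norm (A *v x) \<le> r * norm x"
    using norm_mult_le_opnorm[of A x] mult_right_mono[OF assms(1), of "norm x"] by simp
  then have "\<bar>k\<bar> * norm (A *v x) \<le> l * (r * norm x)"
    using assms by (intro mult_mono) auto
  finally show "norm ((k *\<^sub>R A) *v x) \<le> l * r * norm x" by simp
qed

lemma opnorm_diff_le: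
  fixes A :: "real^'n^'m"
  assumes "opnorm A \<le> r" "opnorm B \<le> s"
  shows "opnorm (A - B) \<le> r + s"
proof -
  have "opnorm ((- 1) *\<^sub>R B) \<le> 1 * s" using assms by (intro opnorm_scaleR_le) auto
  from opnorm_add_le[OF assms(1) this] show ?thesis by simp
qed

lemma opnorm_transpose_le:
  fixes A :: "real^'n^'m"
  assumes "opnorm A \<le> r"
  shows "opnorm (transpose A) \<le> r"
proof (rule opnorm_le_bilinear)
  show "0 \<le> r" using assms opnorm_nonneg order_trans by blast
  fix x :: "real^'n" and y :: "real^'m"
  have "x \<bullet> (transpose A *v y) \<le> norm (A *v x) * norm y"
    unfolding inner_transpose_right by (rule norm_cauchy_schwarz)
  also have "\<dots> \<le> r * norm x * norm y"
    using norm_mult_le_opnorm[of A x] mult_right_mono[OF assms, of "norm x"]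
    by (intro mult_right_mono) auto
  finally show "x \<bullet> (transpose A *v y) \<le> r * (norm x * norm y)" by simp
qed

lemma opnorm_one_le: "opnorm (mat 1 :: real^'n^'n) \<le> 1"
  by (rule opnorm_le) auto

lemma opnorm_integral_le:
  fixes f :: "'x \<Rightarrow> real^'n^'m"
  assumes "prob_space P" and f: "\<And>\<theta>. \<theta> \<in> space P \<Longrightarrow> opnorm (f \<theta>) \<le> k"
  shows "opnorm (\<integral>\<theta>. f \<theta> \<partial>P) \<le> k"
proof -
  interpret prob_space P by fact
  \<comment> \<open>A probability space has a point, and the bound at that point shows that
    \<open>k\<close> is nonnegative.\<close>
  obtain \<theta> where "\<theta> \<in> space P" using not_empty by blast
  from order_trans[OF opnorm_nonneg f[OF this]] have k: "0 \<le> k" .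
  show ?thesis
  proof (cases "integrable P f")
    case True
    show ?thesis
    proof (rule opnorm_le_bilinear[OF _ k])
      fix x y
      have "x \<bullet> ((\<integral>\<theta>. f \<theta> \<partial>P) *v y) = (\<integral>\<theta>. x \<bullet> (f \<theta> *v y) \<partial>P)"
        by (rule integral_bounded_linear[OF bounded_linear_quadratic_form True, symmetric])
      also have "\<dots> \<le> k * (norm x * norm y)"
      proof (rule integral_le_const)
        show "integrable P (\<lambda>\<theta>. x \<bullet> (f \<theta> *v y))"
          by (rule integrable_bounded_linear[OF bounded_linear_quadratic_form True])
        show "AE \<theta> in P. x \<bullet> (f \<theta> *v y) \<le> k * (norm x * norm y)"
        proof (rule AE_I2)
          fix \<theta> assume \<theta>: "\<theta> \<in> space P"
          have "x \<bullet> (f \<theta> *v y) \<le> norm x * norm (f \<theta> *v y)" by (rule norm_cauchy_schwarz)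
          also have "\<dots> \<le> norm x * (k * norm y)"
            using norm_mult_le_opnorm[of "f \<theta>" y] mult_right_mono[OF f[OF \<theta>], of "norm y"]
            by (intro mult_left_mono) auto
          finally show "x \<bullet> (f \<theta> *v y) \<le> k * (norm x * norm y)" by (simp add: mult_ac)
        qed
      qed
      finally show "x \<bullet> ((\<integral>\<theta>. f \<theta> \<partial>P) *v y) \<le> k * (norm x * norm y)" .
    qed
  next
    \<comment> \<open>The Bochner integral of a non-integrable function is 0, which obeys every
      nonnegative bound.\<close>
    case False
    then show ?thesis
      using k by (auto simp: not_integrable_integral_eq intro!: opnorm_le)
  qed
qed

lemma psd_integral:
  fixes f :: "'x \<Rightarrow> real^'n^'n"
  assumes int: "integrable P f" and f: "\<And>\<theta>. \<theta> \<in> space P \<Longrightarrow> f \<theta> \<in> psd_mats"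
  shows "(\<integral>\<theta>. f \<theta> \<partial>P) \<in> psd_mats"
proof (rule psd_matsI)
  have "transpose (\<integral>\<theta>. f \<theta> \<partial>P) = (\<integral>\<theta>. transpose (f \<theta>) \<partial>P)"
    by (rule integral_bounded_linear[OF bounded_linear_transpose int, symmetric])
  also have "\<dots> = (\<integral>\<theta>. f \<theta> \<partial>P)"
    using f by (intro Bochner_Integration.integral_cong) (auto simp: psd_matsD)
  finally show "transpose (\<integral>\<theta>. f \<theta> \<partial>P) = (\<integral>\<theta>. f \<theta> \<partial>P)" .
  fix x
  have "x \<bullet> ((\<integral>\<theta>. f \<theta> \<partial>P) *v x) = (\<integral>\<theta>. x \<bullet> (f \<theta> *v x) \<partial>P)"
    by (rule integral_bounded_linear[OF bounded_linear_quadratic_form int, symmetric])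
  also have "\<dots> \<ge> 0"
    using f by (intro integral_nonneg_AE AE_I2) (auto simp: psd_matsD)
  finally show "0 \<le> x \<bullet> ((\<integral>\<theta>. f \<theta> \<partial>P) *v x)" .
qed

lemma psd_add: "A \<in> psd_mats \<Longrightarrow> B \<in> psd_mats \<Longrightarrow> A + B \<in> psd_mats"
  by (intro psd_matsI) (auto simp: transpose_simps psd_matsD matrix_vector_mult_add_rdistrib inner_add_right)

lemma psd_scaleR: "A \<in> psd_mats \<Longrightarrow> 0 \<le> k \<Longrightarrow> k *\<^sub>R A \<in> psd_mats"
  by (intro psd_matsI) (auto simp: transpose_simps psd_matsD simp flip: scaleR_matrix_vector_assoc)

lemma psd_congruence:
  fixes X :: "real^'n^'n"
  assumes "A \<in> psd_mats"
  shows "transpose X ** A ** X \<in> psd_mats"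
  using assms
  by (intro psd_matsI) (auto simp: transpose_simps psd_matsD matrix_mul_assoc matrix_vector_mult_mult inner_transpose_right)

lemma psd_mult_transpose: "B ** transpose B \<in> psd_mats" for B :: "real^'d^'n"
proof (rule psd_matsI)
  show "0 \<le> x \<bullet> ((B ** transpose B) *v x)" for x
    using inner_transpose_left[of B x "transpose B *v x"] inner_ge_zero[of "transpose B *v x"]
    by (simp add: matrix_vector_mult_mult del: inner_ge_zero)
qed (simp add: transpose_simps)

text \<open>With \<open>v = p *v x\<close> the form becomes an expression in \<open>x\<close> and
  \<open>v\<close> that is linear in the coefficients, so the integrals defining them can be merged
  into one.\<close>

lemma riccati_form:
  fixes p :: "real^'n^'n"
  assumes "transpose p = p"
  shows "x \<bullet> (riccati_rhs a b c p *v x) =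
    (p *v x) \<bullet> (c *v (p *v x)) + 2 * (x \<bullet> (a *v (p *v x))) - x \<bullet> (b *v x)"
proof -
  have p: "y \<bullet> (p *v z) = (p *v y) \<bullet> z" for y z
    using inner_transpose_right[of y p z] assms by simp
  have "x \<bullet> (riccati_rhs a b c p *v x) =
      x \<bullet> (p *v (c *v (p *v x))) + x \<bullet> (a *v (p *v x)) + x \<bullet> (p *v (transpose a *v x)) - x \<bullet> (b *v x)"
    by (simp add: riccati_rhs_def matrix_vector_mult_diff_rdistrib matrix_vector_mult_add_rdistrib
        matrix_vector_mult_mult inner_diff_right inner_add_right)
  also have "x \<bullet> (p *v (transpose a *v x)) = x \<bullet> (a *v (p *v x))"
    by (simp add: p inner_transpose_right inner_commute)
  finally show ?thesis by (simp add: p)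
qed

section \<open>The coefficients along one fixed history\<close>

locale jump_coefficients =
  fixes T N nA nB nC :: real
    and j :: nat
    and E :: "'a::metric_space set"
    and \<Delta> :: 'a
    and lam :: "'a \<times> real \<Rightarrow> real"
    and Q :: "'a \<Rightarrow> real \<Rightarrow> 'a measure"
    and A :: "'a history \<times> real \<Rightarrow> real^'n^'n"
    and B :: "'a history \<times> real \<Rightarrow> real^'d^'n"
    and C :: "'a history \<times> real \<times> 'a \<Rightarrow> real^'n^'n"
    and e :: "'a history"
  assumes T: "T > 0"
    and lam_cont: "continuous_on (E \<times> {0..}) lam"
    and lam_nonneg: "\<And>\<gamma> t. \<gamma> \<in> E \<Longrightarrow> t \<ge> 0 \<Longrightarrow> lam (\<gamma>, t) \<ge> 0"
    and lam_bounded: "bounded (lam ` (E \<times> {0..}))"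
    and lam_cemetery: "\<And>t. t \<ge> 0 \<Longrightarrow> lam (\<Delta>, t) = 0"
    and Q: "\<And>\<gamma>. \<gamma> \<in> E \<Longrightarrow> Q \<gamma> \<in> restrict_space borel {0..} \<rightarrow>\<^sub>M prob_algebra (restrict_space borel E)"
    and A_meas: "A \<in> borel_measurable (restrict_space borel (hist_space T E \<Delta> j \<times> {0..T}))"
    and A_le: "\<And>x. x \<in> hist_space T E \<Delta> j \<times> {0..T} \<Longrightarrow> opnorm (A x) \<le> nA"
    and B_meas: "B \<in> borel_measurable (restrict_space borel (hist_space T E \<Delta> j \<times> {0..T}))"
    and B_le: "\<And>x. x \<in> hist_space T E \<Delta> j \<times> {0..T} \<Longrightarrow> opnorm (B x) \<le> nB"
    and C_meas: "C \<in> borel_measurable (restrict_space borel (hist_space T E \<Delta> j \<times> {0..T} \<times> E))"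
    and C_le: "\<And>x. x \<in> hist_space T E \<Delta> j \<times> {0..T} \<times> E \<Longrightarrow> opnorm (C x) \<le> nC"
    and N: "N \<ge> 1"
    and e: "e \<in> hist_space T E \<Delta> j"
begin

abbreviation "\<gamma> \<equiv> last_mode j e"
abbreviation "nlam \<equiv> intensity_sup E \<Delta> lam"
abbreviation "\<Sigma> \<equiv> Linf (hist_space T E \<Delta> (Suc j) \<times> {0..T}) (psd_mats :: (real^'n^'n) set)"
abbreviation "a \<equiv> coef_a A C lam Q j e"
abbreviation "b \<equiv> coef_b N B lam Q j e"
abbreviation "c \<equiv> coef_c C lam Q j e"

text \<open>\<open>\<sigma>\<close> enters all three coefficients only through this resolvent, taken
  at the history prolonged by a jump at \<open>t\<close> to \<open>\<theta>\<close>.\<close>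

definition weight :: "('a history \<times> real \<Rightarrow> real^'n^'n) \<Rightarrow> real \<Rightarrow> 'a \<Rightarrow> real^'n^'n" where
  "weight \<sigma> t \<theta> = resolvent (\<sigma> (hist_append j e t \<theta>, t))"

definition jump :: "real \<Rightarrow> 'a \<Rightarrow> real^'n^'n" where
  "jump t \<theta> = C (e, t, \<theta>) + mat 1"

lemma e_last: "e j \<in> jump_space T E \<Delta>"
  using e by (auto simp: hist_space_def PiE_iff)

text \<open>A last jump time below a real number is not infinite, which rules out the cemetery pair.
  Thus the law \<open>Q\<close> is consulted only at modes in \<open>E\<close>.\<close>

lemma active_mode:
  assumes "last_time j e < ereal t"
  shows "\<gamma> \<in> E"
  using e_last assms by (auto simp: jump_space_def last_time_def last_mode_def)

lemma hist_append_mem: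
  assumes "t \<in> {0..T}" "\<theta> \<in> E"
  shows "hist_append j e t \<theta> \<in> hist_space T E \<Delta> (Suc j)"
  using e assms by (auto simp: hist_space_def PiE_iff hist_append_def jump_space_def extensional_def)

lemma nA_nonneg: "0 \<le> nA"
  using order_trans[OF opnorm_nonneg A_le[of "(e, 0)"]] e T by auto

lemma nC_nonneg: "\<theta> \<in> E \<Longrightarrow> 0 \<le> nC"
  using order_trans[OF opnorm_nonneg C_le[of "(e, 0, \<theta>)"]] e T by auto

lemma bdd_above_lam: "bdd_above (lam ` (insert \<Delta> E \<times> {0..}))"
proof -
  have "lam ` (insert \<Delta> E \<times> {0..}) \<subseteq> insert 0 (lam ` (E \<times> {0..}))"
    using lam_cemetery by auto
  moreover have "bdd_above (insert 0 (lam ` (E \<times> {0..})))"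
    using bounded_imp_bdd_above[OF lam_bounded] by simp
  ultimately show ?thesis by (rule bdd_above_mono[rotated])
qed

lemma lam_le: "\<gamma>' \<in> E \<Longrightarrow> 0 \<le> t \<Longrightarrow> lam (\<gamma>', t) \<le> nlam"
  unfolding intensity_sup_def by (rule cSUP_upper[OF _ bdd_above_lam]) auto

lemma nlam_nonneg: "0 \<le> nlam"
  unfolding intensity_sup_def using cSUP_upper[OF _ bdd_above_lam, of "(\<Delta>, 0)"] lam_cemetery[of 0] by auto

text \<open>If \<open>E\<close> is empty, the bound on \<open>C\<close> is vacuous and
  \<open>nC\<close> may be negative. The supremum then ranges over the cemetery alone, and
  \<open>nlam\<close> is 0.\<close>

lemma nlam_nC_nonneg: "0 \<le> nlam * (nC + 1)"
proof (cases "E = {}")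
  case True
  then have "nlam = (SUP x \<in> {\<Delta>} \<times> {0::real..}. 0)"
    unfolding intensity_sup_def using lam_cemetery by (intro SUP_cong) auto
  also have "\<dots> = 0" by (rule cSUP_const) auto
  finally show ?thesis by simp
next
  case False
  then show ?thesis using nC_nonneg nlam_nonneg by (auto intro!: mult_nonneg_nonneg)
qed

lemma \<sigma>_psd: "\<sigma> \<in> \<Sigma> \<Longrightarrow> t \<in> {0..T} \<Longrightarrow> \<theta> \<in> E \<Longrightarrow> \<sigma> (hist_append j e t \<theta>, t) \<in> psd_mats"
  using hist_append_mem by (auto simp: Linf_def Pi_iff)

text \<open>The Borel sets of a history space can exceed the product
  \<open>\<sigma>\<close>-algebra, so measurability of the coordinates would not suffice. The
  prolongation of the history is continuous in \<open>(t, \<theta>)\<close> instead, coordinate by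
  coordinate.\<close>

lemma weight_meas:
  assumes "\<sigma> \<in> \<Sigma>"
  shows "(\<lambda>(t, \<theta>). weight \<sigma> t \<theta>) \<in> borel_measurable (restrict_space borel ({0..T} \<times> E))"
proof -
  let ?h = "\<lambda>(t, \<theta>). (hist_append j e t \<theta>, t)"
  have "continuous_on ({0..T} \<times> E) ?h"
    unfolding hist_append_def case_prod_beta
  proof (intro continuous_on_Pair continuous_on_coordinatewise_then_product continuous_on_fst continuous_on_id)
    show "continuous_on ({0..T} \<times> E) (\<lambda>x. (e(Suc j := (ereal (fst x), snd x))) i)" for i
      by (cases "i = Suc j") (auto intro!: continuous_intros)
  qed
  then have "?h \<in> borel_measurable (restrict_space borel ({0..T} \<times> E))"
    by (rule borel_measurable_continuous_on_restrict)
  then have "?h \<in> restrict_space borel ({0..T} \<times> E) \<rightarrow>\<^sub>M restrict_space borel (hist_space T E \<Delta> (Suc j) \<times> {0..T})"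
    using hist_append_mem by (intro measurable_restrict_space2) (auto simp: space_restrict_space)
  moreover have "\<sigma> \<in> borel_measurable (restrict_space borel (hist_space T E \<Delta> (Suc j) \<times> {0..T}))"
    using assms by (simp add: Linf_def)
  ultimately have "(\<lambda>x. \<sigma> (?h x)) \<in> borel_measurable (restrict_space borel ({0..T} \<times> E))"
    by (rule measurable_compose)
  then have "(\<lambda>x. resolvent (\<sigma> (?h x))) \<in> borel_measurable (restrict_space borel ({0..T} \<times> E))"
    using \<sigma>_psd[OF assms] by (intro measurable_resolvent) (auto simp: space_restrict_space)
  then show ?thesis by (simp add: weight_def case_prod_beta)
qed

lemma jump_meas: "(\<lambda>(t, \<theta>). jump t \<theta>) \<in> borel_measurable (restrict_space borel ({0..T} \<times> E))"
proof -
  let ?h = "\<lambda>x :: real \<times> 'a. (e, fst x, snd x)"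
  have "?h \<in> borel_measurable (restrict_space borel ({0..T} \<times> E))"
    by (intro borel_measurable_continuous_on_restrict continuous_intros)
  then have "?h \<in> restrict_space borel ({0..T} \<times> E) \<rightarrow>\<^sub>M restrict_space borel (hist_space T E \<Delta> j \<times> {0..T} \<times> E)"
    using e by (intro measurable_restrict_space2) (auto simp: space_restrict_space)
  from measurable_compose[OF this C_meas] show ?thesis
    unfolding jump_def case_prod_beta by (intro borel_measurable_add borel_measurable_const)
qed

lemma lam_meas:
  assumes "\<gamma> \<in> E"
  shows "(\<lambda>(t, \<theta>). lam (\<gamma>, t)) \<in> borel_measurable (restrict_space borel ({0..T} \<times> E))"
proof -
  have "continuous_on ({0..T} \<times> E) (\<lambda>x. lam (\<gamma>, fst x))"
    by (rule continuous_on_compose2[OF lam_cont]) (use assms in \<open>auto intro!: continuous_intros\<close>)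
  then show ?thesis
    by (simp add: borel_measurable_continuous_on_restrict case_prod_beta)
qed

lemma Q_kernel:
  assumes "\<gamma> \<in> E"
  shows "Q \<gamma> \<in> restrict_space borel {0..T} \<rightarrow>\<^sub>M prob_algebra (restrict_space borel E)"
proof -
  have "(\<lambda>x. x) \<in> restrict_space borel {0..T} \<rightarrow>\<^sub>M restrict_space borel {0::real..}"
    by (intro measurable_restrict_space2 measurable_restrict_space1) (auto simp: space_restrict_space)
  from measurable_compose[OF this Q[OF assms]] show ?thesis .
qed

lemma
  assumes "\<gamma> \<in> E" "t \<in> {0..T}"
  shows prob_space_Q: "prob_space (Q \<gamma> t)"
    and sets_Q: "sets (Q \<gamma> t) = sets (restrict_space borel E)"
    and space_Q: "space (Q \<gamma> t) = E"
proof -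
  have "Q \<gamma> t \<in> space (prob_algebra (restrict_space borel E))"
    using measurable_space[OF Q_kernel[OF assms(1)], of t] assms(2) by (simp add: space_restrict_space)
  then show "prob_space (Q \<gamma> t)" and *: "sets (Q \<gamma> t) = sets (restrict_space borel E)"
    by (auto simp: space_prob_algebra)
  from sets_eq_imp_space_eq[OF *] show "space (Q \<gamma> t) = E" by (simp add: space_restrict_space)
qed

lemma pair_meas:
  assumes "g \<in> borel_measurable (restrict_space borel ({0..T} \<times> E))"
  shows "g \<in> borel_measurable (restrict_space borel {0..T} \<Otimes>\<^sub>M restrict_space borel E)"
  using measurable_compose[OF measurable_pair_borel assms] .

lemma Q_integrable:
  fixes g :: "real \<times> 'a \<Rightarrow> 'v::euclidean_space"
  assumes \<gamma>: "\<gamma> \<in> E" and t: "t \<in> {0..T}"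
    and g: "g \<in> borel_measurable (restrict_space borel ({0..T} \<times> E))"
    and K: "\<And>\<theta>. \<theta> \<in> E \<Longrightarrow> norm (g (t, \<theta>)) \<le> K"
  shows "integrable (Q \<gamma> t) (\<lambda>\<theta>. g (t, \<theta>))"
proof -
  interpret prob_space "Q \<gamma> t" by (rule prob_space_Q[OF \<gamma> t])
  have "(\<lambda>\<theta>. g (t, \<theta>)) \<in> borel_measurable (restrict_space borel E)"
    using t by (intro measurable_compose[OF _ pair_meas[OF g]] measurable_Pair1') (auto simp: space_restrict_space)
  then have "(\<lambda>\<theta>. g (t, \<theta>)) \<in> borel_measurable (Q \<gamma> t)"
    by (simp add: sets_Q[OF \<gamma> t] cong: measurable_cong_sets)
  then show ?thesis
    using K by (intro integrable_const_bound[of _ K] AE_I2) (auto simp: space_Q[OF \<gamma> t])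
qed

text \<open>Serves all three coefficients: \<open>h\<close> is the difference for \<open>a\<close>,
  the sum for \<open>b\<close> and the second projection for \<open>c\<close>. The condition on
  \<open>g\<close> presupposes a mode in \<open>E\<close>, since otherwise no time is active and the
  function is 0.\<close>

lemma coef_meas:
  fixes g :: "real \<times> 'a \<Rightarrow> 'v::euclidean_space"
  assumes g: "\<gamma> \<in> E \<Longrightarrow> g \<in> borel_measurable (restrict_space borel ({0..T} \<times> E))"
    and f: "(f :: real \<Rightarrow> 'v) \<in> borel_measurable (restrict_space borel {0..T})"
    and h: "h \<in> borel_measurable borel"
  shows "(\<lambda>t. if last_time j e < ereal t then h (f t, \<integral>\<theta>. g (t, \<theta>) \<partial>Q \<gamma> t) else (0 :: 'w::euclidean_space))
    \<in> borel_measurable (restrict_space borel {0..T})"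
proof (cases "\<gamma> \<in> E")
  case True
  have "(\<lambda>t. \<integral>\<theta>. g (t, \<theta>) \<partial>Q \<gamma> t) \<in> borel_measurable (restrict_space borel {0..T})"
    by (rule measurable_kernel_integral[OF pair_meas[OF g[OF True]] Q_kernel[OF True]])
  from measurable_compose[OF borel_measurable_Pair[OF f this] h]
  have "(\<lambda>t. h (f t, \<integral>\<theta>. g (t, \<theta>) \<partial>Q \<gamma> t)) \<in> borel_measurable (restrict_space borel {0..T})" .
  moreover have "Measurable.pred (restrict_space borel {0..T}) (\<lambda>t. last_time j e < ereal t)"
    by (intro measurable_restrict_space1) measurable
  ultimately show ?thesis
    by (intro measurable_If) (auto simp: pred_def)
next
  case False
  then have "\<not> last_time j e < ereal t" for t
    using active_mode by blast
  then show ?thesis by simp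
qed


section \<open>Size, measurability, sign and order of the coefficients\<close>

lemma
  assumes \<sigma>: "\<sigma> \<in> \<Sigma>" and t: "t \<in> {0..T}" and \<theta>: "\<theta> \<in> E"
  shows opnorm_weight_le: "opnorm (weight \<sigma> t \<theta>) \<le> 1"
    and weight_psd: "weight \<sigma> t \<theta> \<in> psd_mats"
    and opnorm_compl_weight_le: "opnorm (mat 1 - weight \<sigma> t \<theta>) \<le> 1"
    and compl_weight_psd: "mat 1 - weight \<sigma> t \<theta> \<in> psd_mats"
    and mult_weight_eq: "\<sigma> (hist_append j e t \<theta>, t) ** matrix_inv (mat 1 + \<sigma> (hist_append j e t \<theta>, t)) =
      mat 1 - weight \<sigma> t \<theta>"
proof -
  note S = \<sigma>_psd[OF \<sigma> t \<theta>]
  show eq: "\<sigma> (hist_append j e t \<theta>, t) ** matrix_inv (mat 1 + \<sigma> (hist_append j e t \<theta>, t)) = mat 1 - weight \<sigma> t \<theta>"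
    using mult_resolvent_eq[OF S] by (simp add: weight_def resolvent_def)
  show "opnorm (weight \<sigma> t \<theta>) \<le> 1" "weight \<sigma> t \<theta> \<in> psd_mats"
    unfolding weight_def by (rule opnorm_resolvent_le[OF S], rule resolvent_psd[OF S])
  show "opnorm (mat 1 - weight \<sigma> t \<theta>) \<le> 1" "mat 1 - weight \<sigma> t \<theta> \<in> psd_mats"
    unfolding eq[symmetric] resolvent_def[symmetric]
    by (rule opnorm_mult_resolvent_le[OF S], rule mult_resolvent_psd[OF S])
qed

lemma opnorm_jump_le: "t \<in> {0..T} \<Longrightarrow> \<theta> \<in> E \<Longrightarrow> opnorm (jump t \<theta>) \<le> nC + 1"
  unfolding jump_def using e by (intro opnorm_add_le C_le opnorm_one_le) auto

definition integrand_a :: "('a history \<times> real \<Rightarrow> real^'n^'n) \<Rightarrow> real \<times> 'a \<Rightarrow> real^'n^'n" where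
  "integrand_a \<sigma> = (\<lambda>(t, \<theta>). lam (\<gamma>, t) *\<^sub>R ((mat 1 - weight \<sigma> t \<theta>) ** jump t \<theta>))"

definition integrand_b :: "('a history \<times> real \<Rightarrow> real^'n^'n) \<Rightarrow> real \<times> 'a \<Rightarrow> real^'n^'n" where
  "integrand_b \<sigma> = (\<lambda>(t, \<theta>). lam (\<gamma>, t) *\<^sub>R (mat 1 - weight \<sigma> t \<theta>))"

definition integrand_c :: "('a history \<times> real \<Rightarrow> real^'n^'n) \<Rightarrow> real \<times> 'a \<Rightarrow> real^'n^'n" where
  "integrand_c \<sigma> = (\<lambda>(t, \<theta>). lam (\<gamma>, t) *\<^sub>R (transpose (jump t \<theta>) ** weight \<sigma> t \<theta> ** jump t \<theta>))"

lemma integrand_meas: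
  assumes "\<sigma> \<in> \<Sigma>" "\<gamma> \<in> E"
  shows "integrand_a \<sigma> \<in> borel_measurable (restrict_space borel ({0..T} \<times> E))"
    and "integrand_b \<sigma> \<in> borel_measurable (restrict_space borel ({0..T} \<times> E))"
    and "integrand_c \<sigma> \<in> borel_measurable (restrict_space borel ({0..T} \<times> E))"
  unfolding integrand_a_def integrand_b_def integrand_c_def case_prod_beta
  using weight_meas[OF assms(1), unfolded case_prod_beta] jump_meas[unfolded case_prod_beta]
    lam_meas[OF assms(2), unfolded case_prod_beta]
  by measurable

lemma abs_lam_le: "\<gamma> \<in> E \<Longrightarrow> t \<in> {0..T} \<Longrightarrow> \<bar>lam (\<gamma>, t)\<bar> \<le> nlam"
  using lam_le[of \<gamma> t] lam_nonneg[of \<gamma> t] by auto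

lemma opnorm_integrand_le:
  assumes "\<sigma> \<in> \<Sigma>" "\<gamma> \<in> E" "t \<in> {0..T}" "\<theta> \<in> E"
  shows "opnorm (integrand_a \<sigma> (t, \<theta>)) \<le> nlam * (nC + 1)"
    and "opnorm (integrand_b \<sigma> (t, \<theta>)) \<le> nlam"
    and "opnorm (integrand_c \<sigma> (t, \<theta>)) \<le> nlam * (nC + 1)\<^sup>2"
proof -
  note J = opnorm_jump_le[OF assms(3,4)] and W = opnorm_weight_le[OF assms(1,3,4)]
    and cW = opnorm_compl_weight_le[OF assms(1,3,4)] and lam = abs_lam_le[OF assms(2,3)]
  show "opnorm (integrand_a \<sigma> (t, \<theta>)) \<le> nlam * (nC + 1)"
    using opnorm_scaleR_le[OF opnorm_mult_le[OF cW J] lam] by (simp add: integrand_a_def)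
  show "opnorm (integrand_b \<sigma> (t, \<theta>)) \<le> nlam"
    using opnorm_scaleR_le[OF cW lam] by (simp add: integrand_b_def)
  show "opnorm (integrand_c \<sigma> (t, \<theta>)) \<le> nlam * (nC + 1)\<^sup>2"
    using opnorm_scaleR_le[OF opnorm_mult_le[OF opnorm_mult_le[OF opnorm_transpose_le[OF J] W] J] lam]
    by (simp add: integrand_c_def power2_eq_square)
qed

lemma norm_le_of_opnorm_le:
  fixes X :: "real^'n^'n"
  assumes "opnorm X \<le> k"
  shows "norm X \<le> real CARD('n) * real CARD('n) * k"
  by (rule order_trans[OF norm_le_opnorm mult_left_mono[OF assms]]) simp

lemma integrand_integrable:
  assumes "\<sigma> \<in> \<Sigma>" "\<gamma> \<in> E" "t \<in> {0..T}"
  shows "integrable (Q \<gamma> t) (\<lambda>\<theta>. integrand_a \<sigma> (t, \<theta>))"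
    and "integrable (Q \<gamma> t) (\<lambda>\<theta>. integrand_b \<sigma> (t, \<theta>))"
    and "integrable (Q \<gamma> t) (\<lambda>\<theta>. integrand_c \<sigma> (t, \<theta>))"
  by (rule Q_integrable[OF assms(2,3)], rule integrand_meas[OF assms(1,2)],
      rule norm_le_of_opnorm_le[OF opnorm_integrand_le(1)[OF assms]], assumption)
     (rule Q_integrable[OF assms(2,3)], rule integrand_meas[OF assms(1,2)],
      rule norm_le_of_opnorm_le[OF opnorm_integrand_le(2)[OF assms]], assumption,
      rule Q_integrable[OF assms(2,3)], rule integrand_meas[OF assms(1,2)],
      rule norm_le_of_opnorm_le[OF opnorm_integrand_le(3)[OF assms]], assumption)

lemma coef_eq:
  assumes \<sigma>: "\<sigma> \<in> \<Sigma>" and t: "t \<in> {0..T}"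
  shows "a \<sigma> t = (if last_time j e < ereal t
      then A (e, t) + (1/2) *\<^sub>R mat 1 - (\<integral>\<theta>. integrand_a \<sigma> (t, \<theta>) \<partial>Q \<gamma> t) else 0)"
    and "b \<sigma> t = (if last_time j e < ereal t
      then N *\<^sub>R (B (e, t) ** transpose (B (e, t))) + (\<integral>\<theta>. integrand_b \<sigma> (t, \<theta>) \<partial>Q \<gamma> t) else 0)"
    and "c \<sigma> t = (if last_time j e < ereal t then (\<integral>\<theta>. integrand_c \<sigma> (t, \<theta>) \<partial>Q \<gamma> t) else 0)"
  unfolding coef_a_def coef_b_def coef_c_def
  by (auto intro!: Bochner_Integration.integral_cong arg_cong2[where f="(-)"] arg_cong2[where f="(+)"]
      simp: space_Q[OF active_mode t] integrand_a_def integrand_b_def integrand_c_def mult_weight_eq[OF \<sigma> t]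
        jump_def transpose_simps weight_def resolvent_def)

lemma
  assumes \<sigma>: "\<sigma> \<in> \<Sigma>"
  shows a_meas: "a \<sigma> \<in> borel_measurable (restrict_space borel {0..T})"
    and b_meas: "b \<sigma> \<in> borel_measurable (restrict_space borel {0..T})"
    and c_meas: "c \<sigma> \<in> borel_measurable (restrict_space borel {0..T})"
proof -
  have "(\<lambda>t. (e, t)) \<in> borel_measurable (restrict_space borel {0..T})"
    by (intro borel_measurable_continuous_on_restrict continuous_intros)
  then have h: "(\<lambda>t. (e, t)) \<in> restrict_space borel {0..T} \<rightarrow>\<^sub>M restrict_space borel (hist_space T E \<Delta> j \<times> {0..T})"
    using e by (intro measurable_restrict_space2) (auto simp: space_restrict_space)
  note A' = measurable_compose[OF h A_meas] and B' = measurable_compose[OF h B_meas]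
  have A'': "(\<lambda>t. A (e, t) + (1/2) *\<^sub>R mat 1) \<in> borel_measurable (restrict_space borel {0..T})"
    using A' by (intro borel_measurable_add borel_measurable_const)
  have B'': "(\<lambda>t. N *\<^sub>R (B (e, t) ** transpose (B (e, t)))) \<in> borel_measurable (restrict_space borel {0..T})"
    using B' by measurable
  note m = integrand_meas[OF \<sigma>]
  have 1: "(\<lambda>(x, y). x - y) \<in> borel_measurable (borel :: ((real^'n^'n) \<times> (real^'n^'n)) measure)"
    and 2: "(\<lambda>(x, y). x + y) \<in> borel_measurable (borel :: ((real^'n^'n) \<times> (real^'n^'n)) measure)"
    and 3: "(\<lambda>(x, y). y) \<in> borel_measurable (borel :: ((real^'n^'n) \<times> (real^'n^'n)) measure)"
    unfolding case_prod_beta by (intro borel_measurable_continuous_onI continuous_intros)+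
  have cong: "f \<in> borel_measurable (restrict_space borel {0..T})"
    if "g \<in> borel_measurable (restrict_space borel {0..T})" "\<And>t. t \<in> {0..T} \<Longrightarrow> f t = g t"
    for f g :: "real \<Rightarrow> real^'n^'n"
    using that by (subst measurable_cong[of _ _ g]) (auto simp: space_restrict_space)
  show "a \<sigma> \<in> borel_measurable (restrict_space borel {0..T})"
    by (rule cong[OF coef_meas[OF m(1) A'' 1]]) (auto simp: coef_eq[OF \<sigma>])
  show "b \<sigma> \<in> borel_measurable (restrict_space borel {0..T})"
    by (rule cong[OF coef_meas[OF m(2) B'' 2]]) (auto simp: coef_eq[OF \<sigma>])
  show "c \<sigma> \<in> borel_measurable (restrict_space borel {0..T})"
    by (rule cong[OF coef_meas[OF m(3) B'' 3]]) (auto simp: coef_eq[OF \<sigma>])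
qed

lemma
  assumes \<sigma>: "\<sigma> \<in> \<Sigma>" and t: "t \<in> {0..T}"
  shows opnorm_a_le: "opnorm (a \<sigma> t) \<le> nA + 1/2 + nlam * (nC + 1)"
    and opnorm_b_le: "opnorm (b \<sigma> t) \<le> N * nB\<^sup>2 + nlam"
    and opnorm_c_le: "opnorm (c \<sigma> t) \<le> nlam * (nC + 1)\<^sup>2"
    and b_psd: "b \<sigma> t \<in> psd_mats"
    and c_psd: "c \<sigma> t \<in> psd_mats"
proof -
  have zero: "opnorm (0 :: real^'n^'n) \<le> k" if "0 \<le> k" for k
    using that by (intro opnorm_le) auto
  have "opnorm (a \<sigma> t) \<le> nA + 1/2 + nlam * (nC + 1) \<and> opnorm (b \<sigma> t) \<le> N * nB\<^sup>2 + nlam \<and>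
      opnorm (c \<sigma> t) \<le> nlam * (nC + 1)\<^sup>2 \<and> b \<sigma> t \<in> psd_mats \<and> c \<sigma> t \<in> psd_mats"
  proof (cases "last_time j e < ereal t")
    \<comment> \<open>The coefficients vanish up to the last jump, so the bounds reduce to
      nonnegativity of the constants, including the case of an empty \<open>E\<close>.\<close>
    case False
    have "(0 :: real^'n^'n) \<in> psd_mats" by (auto intro: psd_matsI)
    moreover have "0 \<le> nA + 1/2 + nlam * (nC + 1)" "0 \<le> N * nB\<^sup>2 + nlam" "0 \<le> nlam * (nC + 1)\<^sup>2"
      using nA_nonneg nlam_nonneg nlam_nC_nonneg N by auto
    ultimately show ?thesis
      using False zero by (simp add: coef_eq[OF \<sigma> t])
  next
    case True
    note \<gamma> = active_mode[OF True]
    note P = prob_space_Q[OF \<gamma> t] and sp = space_Q[OF \<gamma> t] and int = integrand_integrable[OF \<sigma> \<gamma> t]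
    have et: "(e, t) \<in> hist_space T E \<Delta> j \<times> {0..T}" using e t by auto
    have "opnorm (A (e, t) + (1/2) *\<^sub>R mat 1 - (\<integral>\<theta>. integrand_a \<sigma> (t, \<theta>) \<partial>Q \<gamma> t)) \<le> nA + 1/2 * 1 + nlam * (nC + 1)"
      using opnorm_integrand_le(1)[OF \<sigma> \<gamma> t] sp
      by (intro opnorm_diff_le opnorm_add_le opnorm_scaleR_le opnorm_one_le A_le et opnorm_integral_le P) auto
    moreover have "opnorm (N *\<^sub>R (B (e, t) ** transpose (B (e, t))) + (\<integral>\<theta>. integrand_b \<sigma> (t, \<theta>) \<partial>Q \<gamma> t)) \<le> N * (nB * nB) + nlam"
      using opnorm_integrand_le(2)[OF \<sigma> \<gamma> t] sp N
      by (intro opnorm_add_le opnorm_scaleR_le opnorm_mult_le opnorm_transpose_le B_le et opnorm_integral_le P) auto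
    moreover have "opnorm (\<integral>\<theta>. integrand_c \<sigma> (t, \<theta>) \<partial>Q \<gamma> t) \<le> nlam * (nC + 1)\<^sup>2"
      using opnorm_integrand_le(3)[OF \<sigma> \<gamma> t] sp by (intro opnorm_integral_le P) auto
    moreover have lam: "0 \<le> lam (\<gamma>, t)" using lam_nonneg[OF \<gamma>] t by auto
    have "integrand_b \<sigma> (t, \<theta>) \<in> psd_mats" "integrand_c \<sigma> (t, \<theta>) \<in> psd_mats" if "\<theta> \<in> E" for \<theta>
      unfolding integrand_b_def integrand_c_def prod.case
      by (intro psd_scaleR psd_congruence compl_weight_psd[OF \<sigma> t that] weight_psd[OF \<sigma> t that] lam)+
    then have "N *\<^sub>R (B (e, t) ** transpose (B (e, t))) + (\<integral>\<theta>. integrand_b \<sigma> (t, \<theta>) \<partial>Q \<gamma> t) \<in> psd_mats"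
      and "(\<integral>\<theta>. integrand_c \<sigma> (t, \<theta>) \<partial>Q \<gamma> t) \<in> psd_mats"
      using N by (auto intro!: psd_add psd_scaleR psd_mult_transpose psd_integral int simp: sp)
    ultimately show ?thesis
      using True by (simp add: coef_eq[OF \<sigma> t] power2_eq_square)
  qed
  then show "opnorm (a \<sigma> t) \<le> nA + 1/2 + nlam * (nC + 1)" "opnorm (b \<sigma> t) \<le> N * nB\<^sup>2 + nlam"
    "opnorm (c \<sigma> t) \<le> nlam * (nC + 1)\<^sup>2" "b \<sigma> t \<in> psd_mats" "c \<sigma> t \<in> psd_mats"
    by auto
qed

text \<open>\<open>n2\<close> is the factor from the operator norm to the Frobenius norm. The
  resulting constants do not involve \<open>\<sigma>\<close>, which is the origin of all later
  uniformity.\<close>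

lemma riccati_coefficients:
  assumes "\<sigma> \<in> \<Sigma>"
  defines "n2 \<equiv> real CARD('n) * real CARD('n)"
  shows "riccati_coefficients T (n2 * (nA + 1/2 + nlam * (nC + 1))) (n2 * (N * nB\<^sup>2 + nlam)) (n2 * (nlam * (nC + 1)\<^sup>2))
    (a \<sigma>) (b \<sigma>) (c \<sigma>)"
  unfolding n2_def using T assms
  by unfold_locales (auto intro!: a_meas b_meas c_meas norm_le_of_opnorm_le opnorm_a_le opnorm_b_le opnorm_c_le b_psd c_psd)

text \<open>Let \<open>u = (C + I) v\<close> and let \<open>W\<close> be the weight. Up to the
  factor \<open>lam\<close>, \<open>c\<close> contributes \<open><u, W u>\<close>, while
  \<open>a\<close> and \<open>b\<close> contribute \<open>2 <x, W u>\<close> and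
  \<open><x, W x>\<close> together with the terms \<open>- 2 <x, u>\<close> and
  \<open>- <x, x>\<close> that come from the identity in \<open>I - W\<close>. The \<open>W\<close>
  terms form a complete square at \<open>y = x + u\<close>; the others are free of
  \<open>\<sigma>\<close>.\<close>

lemma riccati_coefficient_form:
  fixes v x :: "real^'n"
  assumes \<sigma>: "\<sigma> \<in> \<Sigma>" and t: "t \<in> {0..T}" and active: "last_time j e < ereal t"
  defines "y \<equiv> \<lambda>\<theta>. x + jump t \<theta> *v v"
  defines "g \<equiv> \<lambda>\<theta>. lam (\<gamma>, t) * (y \<theta> \<bullet> (weight \<sigma> t \<theta> *v y \<theta>) - x \<bullet> x - 2 * (x \<bullet> (jump t \<theta> *v v)))"
  shows "v \<bullet> (c \<sigma> t *v v) + 2 * (x \<bullet> (a \<sigma> t *v v)) - x \<bullet> (b \<sigma> t *v x) =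
      2 * (x \<bullet> ((A (e, t) + (1/2) *\<^sub>R mat 1) *v v)) - N * (x \<bullet> ((B (e, t) ** transpose (B (e, t))) *v x)) +
      (\<integral>\<theta>. g \<theta> \<partial>Q \<gamma> t)"
    and "integrable (Q \<gamma> t) g"
proof -
  note \<gamma> = active_mode[OF active]
  note int = integrand_integrable[OF \<sigma> \<gamma> t] and sp = space_Q[OF \<gamma> t]
  have form: "z \<bullet> ((\<integral>\<theta>. f \<theta> \<partial>Q \<gamma> t) *v w) = (\<integral>\<theta>. z \<bullet> (f \<theta> *v w) \<partial>Q \<gamma> t)"
    "integrable (Q \<gamma> t) (\<lambda>\<theta>. z \<bullet> (f \<theta> *v w))"
    if "integrable (Q \<gamma> t) f" for f :: "'a \<Rightarrow> real^'n^'n" and z w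
    using integral_bounded_linear[OF bounded_linear_quadratic_form that]
      integrable_bounded_linear[OF bounded_linear_quadratic_form that] by auto
  have g: "g \<theta> = v \<bullet> (integrand_c \<sigma> (t, \<theta>) *v v) - 2 * (x \<bullet> (integrand_a \<sigma> (t, \<theta>) *v v)) - x \<bullet> (integrand_b \<sigma> (t, \<theta>) *v x)"
    if \<theta>: "\<theta> \<in> E" for \<theta>
  proof -
    define W where "W = weight \<sigma> t \<theta>"
    define u where "u = jump t \<theta> *v v"
    have "(W *v u) \<bullet> x = u \<bullet> (W *v x)"
      using inner_sym_mats[of W u x] weight_psd[OF \<sigma> t \<theta>] by (simp add: psd_mats_def W_def)
    then have W: "u \<bullet> (W *v x) = x \<bullet> (W *v u)"
      by (simp add: inner_commute)
    have "v \<bullet> (integrand_c \<sigma> (t, \<theta>) *v v) = lam (\<gamma>, t) * (u \<bullet> (W *v u))"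
      "x \<bullet> (integrand_a \<sigma> (t, \<theta>) *v v) = lam (\<gamma>, t) * (x \<bullet> u - x \<bullet> (W *v u))"
      "x \<bullet> (integrand_b \<sigma> (t, \<theta>) *v x) = lam (\<gamma>, t) * (x \<bullet> x - x \<bullet> (W *v x))"
      by (simp_all add: integrand_a_def integrand_b_def integrand_c_def u_def W_def matrix_vector_mult_mult
          inner_transpose_right matrix_vector_mult_diff_rdistrib inner_diff_right flip: scaleR_matrix_vector_assoc)
    moreover have "y \<theta> \<bullet> (W *v y \<theta>) = x \<bullet> (W *v x) + 2 * (x \<bullet> (W *v u)) + u \<bullet> (W *v u)"
      by (simp add: y_def matrix_vector_right_distrib inner_add_left inner_add_right W flip: u_def)
    ultimately show ?thesis
      by (simp add: g_def algebra_simps flip: u_def W_def)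
  qed
  have int': "integrable (Q \<gamma> t) (\<lambda>\<theta>. v \<bullet> (integrand_c \<sigma> (t, \<theta>) *v v) - 2 * (x \<bullet> (integrand_a \<sigma> (t, \<theta>) *v v)) - x \<bullet> (integrand_b \<sigma> (t, \<theta>) *v x))"
    by (intro Bochner_Integration.integrable_diff integrable_mult_right form int)
  then show "integrable (Q \<gamma> t) g"
    by (rule Bochner_Integration.integrable_cong[THEN iffD2, rotated 2]) (simp_all add: g sp)
  have "(\<integral>\<theta>. g \<theta> \<partial>Q \<gamma> t) = (\<integral>\<theta>. v \<bullet> (integrand_c \<sigma> (t, \<theta>) *v v) - 2 * (x \<bullet> (integrand_a \<sigma> (t, \<theta>) *v v)) - x \<bullet> (integrand_b \<sigma> (t, \<theta>) *v x) \<partial>Q \<gamma> t)"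
    by (intro Bochner_Integration.integral_cong) (auto simp: g sp)
  also have "\<dots> = v \<bullet> ((\<integral>\<theta>. integrand_c \<sigma> (t, \<theta>) \<partial>Q \<gamma> t) *v v) - 2 * (x \<bullet> ((\<integral>\<theta>. integrand_a \<sigma> (t, \<theta>) \<partial>Q \<gamma> t) *v v))
      - x \<bullet> ((\<integral>\<theta>. integrand_b \<sigma> (t, \<theta>) \<partial>Q \<gamma> t) *v x)"
    using form(2)[OF int(1)] form(2)[OF int(2)] form(2)[OF int(3)] by (simp add: form(1)[OF int(1)] form(1)[OF int(2)] form(1)[OF int(3)])
  finally show "v \<bullet> (c \<sigma> t *v v) + 2 * (x \<bullet> (a \<sigma> t *v v)) - x \<bullet> (b \<sigma> t *v x) =
      2 * (x \<bullet> ((A (e, t) + (1/2) *\<^sub>R mat 1) *v v)) - N * (x \<bullet> ((B (e, t) ** transpose (B (e, t))) *v x)) +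
      (\<integral>\<theta>. g \<theta> \<partial>Q \<gamma> t)"
    using active
    by (simp add: coef_eq[OF \<sigma> t] matrix_vector_mult_diff_rdistrib matrix_vector_mult_add_rdistrib[of _ "integral\<^sup>L _ _"]
        inner_diff_right inner_add_right flip: scaleR_matrix_vector_assoc)
qed

text \<open>Supplies the ordering that \<open>riccati_comparison\<close> asks for. With the same
  \<open>p\<close> on both sides, only the integral of the weight at \<open>y\<close> differs; the
  smaller matrix has the larger resolvent, and \<open>lam\<close> is nonnegative.\<close>

lemma riccati_rhs_antimono:
  assumes \<sigma>: "\<sigma> \<in> \<Sigma>" and \<eta>: "\<eta> \<in> \<Sigma>" and t: "t \<in> {0..T}" and p: "transpose p = p"
    and le: "\<And>x. x \<in> hist_space T E \<Delta> (Suc j) \<times> {0..T} \<Longrightarrow> \<eta> x \<preceq> \<sigma> x"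
  shows "x \<bullet> (riccati_rhs (a \<sigma> t) (b \<sigma> t) (c \<sigma> t) p *v x) \<le> x \<bullet> (riccati_rhs (a \<eta> t) (b \<eta> t) (c \<eta> t) p *v x)"
proof (cases "last_time j e < ereal t")
  case False
  then show ?thesis by (simp add: coef_eq[OF \<sigma> t] coef_eq[OF \<eta> t])
next
  case True
  note \<gamma> = active_mode[OF True]
  have W: "y \<bullet> (weight \<sigma> t \<theta> *v y) \<le> y \<bullet> (weight \<eta> t \<theta> *v y)" if "\<theta> \<in> E" for \<theta> y
    unfolding weight_def using that t
    by (intro resolvent_antimono \<sigma>_psd[OF \<sigma>] \<sigma>_psd[OF \<eta>] le) (auto simp: hist_append_mem)
  show ?thesis
    unfolding riccati_form[OF p] riccati_coefficient_form(1)[OF \<sigma> t True] riccati_coefficient_form(1)[OF \<eta> t True]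
    using W lam_nonneg[OF \<gamma>] t
    by (intro add_left_mono integral_mono riccati_coefficient_form(2)[OF \<sigma> t True] riccati_coefficient_form(2)[OF \<eta> t True])
       (auto simp: space_Q[OF \<gamma> t] intro!: mult_left_mono)
qed

end

lemma enat_inv_bounds: "1 \<le> M \<Longrightarrow> 0 \<le> enat_inv M \<and> enat_inv M \<le> 1"
  by (cases M) (auto simp: enat_inv_def one_enat_def)

text \<open>\<open>1 \<le> M\<close> excludes \<open>M = 0\<close>, where division by zero gives the
  value 0 and would destroy the ordering.\<close>

lemma enat_inv_antimono: "1 \<le> M \<Longrightarrow> M \<le> M' \<Longrightarrow> enat_inv M' \<le> enat_inv M"
  by (cases M; cases M') (auto simp: enat_inv_def one_enat_def intro: divide_left_mono)

theorem theorem5p3: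
  fixes T N nA nB nC :: real
    and J j :: nat
    and E :: "'a::metric_space set"
    and \<Delta> :: 'a
    and lam :: "'a \<times> real \<Rightarrow> real"
    and Q :: "'a \<Rightarrow> real \<Rightarrow> 'a measure"
    and A :: "nat \<Rightarrow> 'a history \<times> real \<Rightarrow> real^'n^'n"
    and B :: "nat \<Rightarrow> 'a history \<times> real \<Rightarrow> real^'d^'n"
    and C :: "nat \<Rightarrow> 'a history \<times> real \<times> 'a \<Rightarrow> real^'n^'n"
    and e :: "'a history"
  assumes T: "T > 0"
    and J: "J > 1"
    and \<Delta>: "\<Delta> \<notin> E" "\<Delta> isolated_in insert \<Delta> E"
    and lam: "continuous_on (E \<times> {0..}) lam"
      "\<And>\<gamma> t. \<gamma> \<in> E \<Longrightarrow> t \<ge> 0 \<Longrightarrow> lam (\<gamma>, t) \<ge> 0"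
      "bounded (lam ` (E \<times> {0..}))"
      "\<And>t. t \<ge> 0 \<Longrightarrow> lam (\<Delta>, t) = 0"
    and Q: "\<And>\<gamma>. \<gamma> \<in> E \<Longrightarrow>
        Q \<gamma> \<in> restrict_space borel {0..} \<rightarrow>\<^sub>M prob_algebra (restrict_space borel E)"
      "\<And>\<gamma> t. \<gamma> \<in> E \<Longrightarrow> t \<ge> 0 \<Longrightarrow> measure (Q \<gamma> t) {\<gamma>} = 0"
      "weakly_continuous_unif E Q"
    and A: "\<And>i. i \<le> J - 1 \<Longrightarrow>
        A i \<in> borel_measurable (restrict_space borel (hist_space T E \<Delta> i \<times> {0..T}))"
      "\<And>i x. i \<le> J - 1 \<Longrightarrow> x \<in> hist_space T E \<Delta> i \<times> {0..T} \<Longrightarrow> opnorm (A i x) \<le> nA"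
    and B: "\<And>i. i \<le> J - 1 \<Longrightarrow>
        B i \<in> borel_measurable (restrict_space borel (hist_space T E \<Delta> i \<times> {0..T}))"
      "\<And>i x. i \<le> J - 1 \<Longrightarrow> x \<in> hist_space T E \<Delta> i \<times> {0..T} \<Longrightarrow> opnorm (B i x) \<le> nB"
    and C: "\<And>i. i \<le> J - 1 \<Longrightarrow>
        C i \<in> borel_measurable (restrict_space borel (hist_space T E \<Delta> i \<times> {0..T} \<times> E))"
      "\<And>i x. i \<le> J - 1 \<Longrightarrow> x \<in> hist_space T E \<Delta> i \<times> {0..T} \<times> E \<Longrightarrow> opnorm (C i x) \<le> nC"
    and N: "N \<ge> 1"
    and j: "j \<le> J - 1"
    and e: "e \<in> hist_space T E \<Delta> j"
  defines "\<Sigma> \<equiv> Linf (hist_space T E \<Delta> (Suc j) \<times> {0..T}) (psd_mats :: (real^'n^'n) set)"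
    and "a \<equiv> coef_a (A j) (C j) lam Q j e"
    and "b \<equiv> coef_b N (B j) lam Q j e"
    and "c \<equiv> coef_c (C j) lam Q j e"
    and "sol \<equiv> eq_G T N (A j) (B j) (C j) lam Q j e"
    and "nlam \<equiv> intensity_sup E \<Delta> lam"
  shows
    "(\<forall>\<sigma>\<in>\<Sigma>.
        a \<sigma> \<in> Linf {0..T} UNIV \<and> b \<sigma> \<in> Linf {0..T} psd_mats \<and> c \<sigma> \<in> Linf {0..T} psd_mats \<and>
        (\<forall>t\<in>{0..T}.
           opnorm (a \<sigma> t) \<le> nA + 1/2 + nlam * (nC + 1) \<and>
           opnorm (b \<sigma> t) \<le> N * nB\<^sup>2 + nlam \<and>
           opnorm (c \<sigma> t) \<le> nlam * (nC + 1)\<^sup>2)) \<and>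
     (\<forall>\<sigma>\<in>\<Sigma>. \<forall>M\<ge>1. \<exists>p. sol M \<sigma> p \<and> (\<forall>q. sol M \<sigma> q \<longrightarrow> (\<forall>t\<in>{0..T}. q t = p t))) \<and>
     (\<exists>K. \<forall>\<sigma>\<in>\<Sigma>. \<forall>M\<ge>1. \<forall>p. sol M \<sigma> p \<longrightarrow> (\<forall>t\<in>{0..T}. opnorm (p t) \<le> K)) \<and>
     (\<forall>m::nat\<ge>1. \<exists>c\<^sub>M>0. \<forall>\<sigma>\<in>\<Sigma>. \<forall>p. sol (enat m) \<sigma> p \<longrightarrow> (\<forall>t\<in>{0..T}. c\<^sub>M *\<^sub>R mat 1 \<preceq> p t)) \<and>
     (\<forall>\<sigma>\<in>\<Sigma>. \<forall>\<eta>\<in>\<Sigma>. \<forall>M\<ge>1. \<forall>M'\<ge>1.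
        (\<forall>x \<in> hist_space T E \<Delta> (Suc j) \<times> {0..T}. \<eta> x \<preceq> \<sigma> x) \<longrightarrow> M \<le> M' \<longrightarrow>
        (\<forall>p\<^sub>\<sigma> p\<^sub>\<eta>. sol M \<sigma> p\<^sub>\<sigma> \<longrightarrow> sol M' \<eta> p\<^sub>\<eta> \<longrightarrow>
           (\<forall>t\<in>{0..T}. last_time j e \<le> ereal t \<longrightarrow> p\<^sub>\<eta> t \<preceq> p\<^sub>\<sigma> t)))"
proof -
  interpret jc: jump_coefficients T N nA nB nC j E \<Delta> lam Q "A j" "B j" "C j" e
    by unfold_locales (fact T lam Q N e A[OF j] B[OF j] C[OF j])+
  define n2 where "n2 = real CARD('n) * real CARD('n)"
  define na where "na = n2 * (nA + 1/2 + nlam * (nC + 1))"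
  define nb where "nb = n2 * (N * nB\<^sup>2 + nlam)"
  define nc where "nc = n2 * (nlam * (nC + 1)\<^sup>2)"
  have coef: "riccati_coefficients T na nb nc (a \<sigma>) (b \<sigma>) (c \<sigma>)" if "\<sigma> \<in> \<Sigma>" for \<sigma>
    using jc.riccati_coefficients that
    unfolding \<Sigma>_def a_def b_def c_def nlam_def na_def nb_def nc_def n2_def .
  have sol: "sol M \<sigma> p \<longleftrightarrow> psd_riccati_solution T M (a \<sigma>) (b \<sigma>) (c \<sigma>) p" for M \<sigma> p
    by (simp add: sol_def eq_G_def a_def b_def c_def)
  have coefficients: "a \<sigma> \<in> Linf {0..T} UNIV \<and> b \<sigma> \<in> Linf {0..T} psd_mats \<and> c \<sigma> \<in> Linf {0..T} psd_mats \<and>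
      (\<forall>t\<in>{0..T}. opnorm (a \<sigma> t) \<le> nA + 1/2 + nlam * (nC + 1) \<and> opnorm (b \<sigma> t) \<le> N * nB\<^sup>2 + nlam \<and>
        opnorm (c \<sigma> t) \<le> nlam * (nC + 1)\<^sup>2)" if \<sigma>: "\<sigma> \<in> \<Sigma>" for \<sigma>
  proof -
    interpret riccati_coefficients T na nb nc "a \<sigma>" "b \<sigma>" "c \<sigma>" by (rule coef[OF \<sigma>])
    have "bounded (a \<sigma> ` {0..T})" "bounded (b \<sigma> ` {0..T})" "bounded (c \<sigma> ` {0..T})"
      using a_le b_le c_le unfolding bounded_iff by blast+
    then show ?thesis
      using a_meas b_meas c_meas b_psd c_psd \<sigma>
        jc.opnorm_a_le[of \<sigma>] jc.opnorm_b_le[of \<sigma>] jc.opnorm_c_le[of \<sigma>]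
      unfolding a_def[symmetric] b_def[symmetric] c_def[symmetric] nlam_def[symmetric] \<Sigma>_def[symmetric]
      by (simp add: Linf_def Pi_iff)
  qed
  have wellposed: "\<exists>p. sol M \<sigma> p \<and> (\<forall>q. sol M \<sigma> q \<longrightarrow> (\<forall>t\<in>{0..T}. q t = p t))"
    if \<sigma>: "\<sigma> \<in> \<Sigma>" and "M \<ge> 1" for \<sigma> M
  proof -
    interpret riccati_coefficients T na nb nc "a \<sigma>" "b \<sigma>" "c \<sigma>" by (rule coef[OF \<sigma>])
    show ?thesis
      using solution_exists[of M] solution_unique[of M] enat_inv_bounds[OF \<open>M \<ge> 1\<close>] unfolding sol by metis
  qed
  \<comment> \<open>The Frobenius version of the upper bound, fixed before any
    \<open>\<sigma>\<close> and \<open>M\<close>. It enters the rate of the lower bound, whose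
    constant thereby becomes uniform in \<open>\<sigma>\<close>.\<close>
  define r where "r = n2 * exp ((nb + 2 * na) * T)"
  have upper: "opnorm (p t) \<le> exp ((nb + 2 * na) * T)" "norm (p t) \<le> r"
    if \<sigma>: "\<sigma> \<in> \<Sigma>" and "M \<ge> 1" and p: "sol M \<sigma> p" and t: "t \<in> {0..T}" for \<sigma> M p t
  proof -
    interpret riccati_coefficients T na nb nc "a \<sigma>" "b \<sigma>" "c \<sigma>" by (rule coef[OF \<sigma>])
    show "opnorm (p t) \<le> exp ((nb + 2 * na) * T)" "norm (p t) \<le> r"
      using solution_opnorm_le[of M p] solution_norm_le[of M p] enat_inv_bounds[OF \<open>M \<ge> 1\<close>] p t
      unfolding sol r_def n2_def by auto
  qed
  have lower: "(1 / real m * exp (- ((2 * na + r * nc) * T))) *\<^sub>R mat 1 \<preceq> p t"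
    if \<sigma>: "\<sigma> \<in> \<Sigma>" and m: "m \<ge> 1" and p: "sol (enat m) \<sigma> p" and t: "t \<in> {0..T}" for \<sigma> m p t
  proof -
    interpret riccati_coefficients T na nb nc "a \<sigma>" "b \<sigma>" "c \<sigma>" by (rule coef[OF \<sigma>])
    have M: "enat m \<ge> 1" using m by (simp add: one_enat_def)
    have "(enat_inv (enat m) * exp (- ((2 * na + r * nc) * T))) *\<^sub>R mat 1 \<preceq> p t"
      using p enat_inv_bounds[OF M] by (intro solution_ge upper(2)[OF \<sigma> M p] t) (auto simp: sol)
    then show ?thesis by (simp add: enat_inv_def)
  qed
  have monotone: "p\<^sub>\<eta> t \<preceq> p\<^sub>\<sigma> t"
    if \<sigma>: "\<sigma> \<in> \<Sigma>" and \<eta>: "\<eta> \<in> \<Sigma>" and M: "M \<ge> 1" "M \<le> M'"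
      and le: "\<And>x. x \<in> hist_space T E \<Delta> (Suc j) \<times> {0..T} \<Longrightarrow> \<eta> x \<preceq> \<sigma> x"
      and p: "sol M \<sigma> p\<^sub>\<sigma>" "sol M' \<eta> p\<^sub>\<eta>" and t: "t \<in> {0..T}" for \<sigma> \<eta> M M' p\<^sub>\<sigma> p\<^sub>\<eta> t
  \<comment> \<open>The solution for \<open>\<sigma>\<close> plays the part of \<open>p\<close>:
    both right-hand sides are evaluated at \<open>p\<^sub>\<sigma>\<close>, and the smaller
    \<open>M\<close> gives it the larger terminal value.\<close>
  proof (rule riccati_comparison[OF coef[OF \<sigma>] coef[OF \<eta>] _ _ enat_inv_antimono[OF M] _ t])
    show p': "psd_riccati_solution T M (a \<sigma>) (b \<sigma>) (c \<sigma>) p\<^sub>\<sigma>" "psd_riccati_solution T M' (a \<eta>) (b \<eta>) (c \<eta>) p\<^sub>\<eta>"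
      using p by (simp_all add: sol)
    fix s x assume s: "s \<in> {0..T}"
    show "x \<bullet> (riccati_rhs (a \<sigma> s) (b \<sigma> s) (c \<sigma> s) (p\<^sub>\<sigma> s) *v x) \<le> x \<bullet> (riccati_rhs (a \<eta> s) (b \<eta> s) (c \<eta> s) (p\<^sub>\<sigma> s) *v x)"
      unfolding a_def b_def c_def
      by (rule jc.riccati_rhs_antimono[OF _ _ s riccati_coefficients.solution_sym[OF coef[OF \<sigma>] p'(1) s]])
         (use \<sigma> \<eta> le in \<open>auto simp: \<Sigma>_def\<close>)
  qed
  show ?thesis
  proof (intro conjI ballI allI impI)
    fix m :: nat assume m: "1 \<le> m"
    then have "1 / real m * exp (- ((2 * na + r * nc) * T)) > 0" by simp
    with lower[OF _ m] show "\<exists>c\<^sub>M>0. \<forall>\<sigma>\<in>\<Sigma>. \<forall>p. sol (enat m) \<sigma> p \<longrightarrow> (\<forall>t\<in>{0..T}. c\<^sub>M *\<^sub>R mat 1 \<preceq> p t)"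
      by blast
  next
    show "\<exists>K. \<forall>\<sigma>\<in>\<Sigma>. \<forall>M\<ge>1. \<forall>p. sol M \<sigma> p \<longrightarrow> (\<forall>t\<in>{0..T}. opnorm (p t) \<le> K)"
      using upper(1) by blast
  qed (use coefficients wellposed monotone in blast)+
qed

end
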